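(* For $N=4$ one has $\overline{\mathcal{H}}\neq\mathcal{E}^c$ in $\mathrm{SL}(2,\mathbb{R})^4$. More specifically, let $F$ and $H$ be hyperbolic matrices in $\mathrm{SL}(2,\mathbb{R})$ whose induced Möbius transformations form a standard group-generating set for a Schottky group of rank two. Then $(F,F^{-1},H,H^{-1})\notin\mathcal{E}$ and $(F,F^{-1},H,H^{-1})\notin\overline{\mathcal{H}}$.
   Context: A matrix in $\mathrm{SL}(2,\mathbb{R})$ acts on the upper half-plane $\mathbb{H}$ and on $\overline{\mathbb{R}}=\mathbb{R}\cup\{\infty\}$ as a Möbius transformation. It is hyperbolic if the absolute value of its trace exceeds $2$, and elliptic if the absolute value of its trace is less than $2$. $\mathcal{H}\subset\mathrm{SL}(2,\mathbb{R})^N$ (the hyperbolic locus) is the set of $N$-tuples $(A_1,\dots,A_N)$ that are uniformly hyperbolic: there are constants $c>0$ and $\kappa\geq 0$ such that for every sequence $f_1,f_2,\dotsc$ with each $f_i\in\{A_1,\dots,A_N\}$, the products $F_n=f_1\dotsb f_n$ satisfy $\rho(F_n(i),i)\geq cn-\kappa$ for all $n\ge 1$, where $\rho$ is the hyperbolic metric on $\mathbb{H}$ and $i=\sqrt{-1}$. (It is known that $(A_1,\dots,A_N)\in\mathcal{H}$ if and only if there is a nonempty open set $X\subsetneq\overline{\mathbb{R}}$ with finitely many components such that $\overline{A_j(X)}\subset X$ for $j=1,\dots,N$.) $\overline{\mathcal{H}}$ is the closure of $\mathcal{H}$ in $\mathrm{SL}(2,\mathbb{R})^N$. $\mathcal{E}\subset\mathrm{SL}(2,\mathbb{R})^N$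 (the elliptic locus) is the set of $N$-tuples $(A_1,\dots,A_N)$ for which the semigroup $\langle A_1,\dots,A_N\rangle$ of all finite products of the $A_j$ contains an elliptic element. $\mathcal{E}^c$ is its complement in $\mathrm{SL}(2,\mathbb{R})^N$. A pair $\{f_1,f_2\}$ of Möbius transformations is a standard group-generating set for a Schottky group of rank two if there are pairwise disjoint open intervals $A,B,C,D$ in $\overline{\mathbb{R}}$ such that $f_1$ maps the complement of $\overline{A}$ onto $B$ and $f_2$ maps the complement of $\overline{C}$ onto $D$; the Schottky group is the group they generate. *)

theory Defs
  imports "HOL-Analysis.Analysis"
begin

definition SL2R :: "(real^2^2) set" where
  "SL2R = {A. det A = 1}"

definition hyperbolic :: "real^2^2 \<Rightarrow> bool" where
  "hyperbolic A \<longleftrightarrow> \<bar>trace A\<bar> > 2"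

definition elliptic :: "real^2^2 \<Rightarrow> bool" where
  "elliptic A \<longleftrightarrow> \<bar>trace A\<bar> < 2"

definition moebius_H :: "real^2^2 \<Rightarrow> complex \<Rightarrow> complex" where
  "moebius_H A z =
     (of_real (A$1$1) * z + of_real (A$1$2)) / (of_real (A$2$1) * z + of_real (A$2$2))"

text \<open>The hyperbolic metric of curvature -1, meaningful for points with positive imaginary part.\<close>

definition hyp_dist :: "complex \<Rightarrow> complex \<Rightarrow> real" where
  "hyp_dist z w = arcosh (1 + (cmod (z - w))\<^sup>2 / (2 * Im z * Im w))"

text \<open>The extended real line is the one-point compactification of the reals, on the type
  \<^typ>\<open>real option\<close>, with \<^const>\<open>None\<close> as the point at infinity.\<close>

abbreviation ext_real_line :: "real option topology" where
  "ext_real_line \<equiv> Alexandroff_compactification euclideanreal"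

fun moebius_R :: "real^2^2 \<Rightarrow> real option \<Rightarrow> real option" where
  "moebius_R A (Some x) =
     (if A$2$1 * x + A$2$2 = 0 then None
      else Some ((A$1$1 * x + A$1$2) / (A$2$1 * x + A$2$2)))"
| "moebius_R A None = (if A$2$1 = 0 then None else Some (A$1$1 / A$2$1))"

text \<open>\<open>N\<close>-tuples of matrices are elements of \<open>real^2^2^'n\<close> with \<open>N = CARD('n)\<close>.\<close>

definition SL2R_tuples :: "(real^2^2^'n) set" where
  "SL2R_tuples = {A. \<forall>j. A$j \<in> SL2R}"

text \<open>\<open>mat_prod f n\<close> is the product of the first \<open>n\<close> terms \<open>f 0, \<dots>, f (n - 1)\<close>, in this order.\<close>

primrec mat_prod :: "(nat \<Rightarrow> real^2^2) \<Rightarrow> nat \<Rightarrow> real^2^2" where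
  "mat_prod f 0 = mat 1"
| "mat_prod f (Suc n) = mat_prod f n ** f n"

definition uniformly_hyperbolic :: "real^2^2^'n \<Rightarrow> bool" where
  "uniformly_hyperbolic A \<longleftrightarrow>
     (\<exists>c \<kappa>. c > 0 \<and> \<kappa> \<ge> 0 \<and>
       (\<forall>f. (\<forall>k. f k \<in> range (\<lambda>j. A$j)) \<longrightarrow>
         (\<forall>n\<ge>1. hyp_dist (moebius_H (mat_prod f n) \<i>) \<i> \<ge> c * real n - \<kappa>)))"

definition hyperbolic_locus :: "(real^2^2^'n) set" where
  "hyperbolic_locus = {A \<in> SL2R_tuples. uniformly_hyperbolic A}"

inductive_set semigroup_generated :: "(real^2^2) set \<Rightarrow> (real^2^2) set"
  for S :: "(real^2^2) set" where
  gen: "A \<in> S \<Longrightarrow> A \<in> semigroup_generated S"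
| mult: "A \<in> semigroup_generated S \<Longrightarrow> B \<in> semigroup_generated S \<Longrightarrow> A ** B \<in> semigroup_generated S"

definition elliptic_locus :: "(real^2^2^'n) set" where
  "elliptic_locus =
     {A \<in> SL2R_tuples. \<exists>B \<in> semigroup_generated (range (\<lambda>j. A$j)). elliptic B}"

text \<open>Intervals of the circle \<^const>\<open>ext_real_line\<close> are arcs, and may contain the point at infinity.\<close>

definition open_interval :: "real option set \<Rightarrow> bool" where
  "open_interval I \<longleftrightarrow>
     openin ext_real_line I \<and> connectedin ext_real_line I \<and> I \<noteq> {} \<and> I \<noteq> UNIV"

text \<open>The intervals are disjoint, but their closures are allowed to meet.\<close>

definition standard_schottky_generating_set :: "(real option \<Rightarrow> real option) set \<Rightarrow> bool" where
  "standard_schottky_generating_set G \<longleftrightarrow>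
     (\<exists>f g A B C D. G = {f, g} \<and>
        open_interval A \<and> open_interval B \<and> open_interval C \<and> open_interval D \<and>
        disjnt A B \<and> disjnt A C \<and> disjnt A D \<and> disjnt B C \<and> disjnt B D \<and> disjnt C D \<and>
        f ` (- (ext_real_line closure_of A)) = B \<and>
        g ` (- (ext_real_line closure_of C)) = D)"

end

(* The four matrices play ping-pong on open cones in R^2, which rules out elliptic words: all powers
   of a cyclically reduced word map some cone into a disjoint one, whereas powers of an elliptic
   matrix accumulate at the identity.

   If uniformly hyperbolic tuples X k converged to (F, F^-1, H, H^-1), then products such as
   X k $ 1 ** X k $ 2 would be near the identity but different from it, and no element of the
   semigroups would be elliptic. Rescaling these near-identity elements gives, in the limit, a nonzero
   convex cone in sl(2,R) that is invariant under conjugation by F and H and consists of elements of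
   nonpositive determinant. Conjugating by large powers pushes the cone onto null vectors of several
   different directions, and sums of these have positive determinant; so the cone is zero. *)
theory Submission
  imports Defs
begin

section \<open>Two by two matrices\<close>

text \<open>Uniform hyperbolicity excludes from the semigroup every element with bounded powers, the
  identity included, so a uniformly hyperbolic tuple never contains a matrix together with its
  inverse. An element 1 + e V of determinant 1 satisfies trace V = - e det V, so being nonelliptic
  near the identity becomes det V <= 0 in the limit. The obstacle is that approximate inverses
  conjugate only up to an error of the same order e: the set of limits is invariant only up to
  translation. Its asymptotic directions do not see bounded translations, and they form the cone to
  which the final argument applies.\<close>

lemma matrix_mult_2_nth:
  "((A::real^2^2) ** B)$i$j = A$i$1 * B$1$j + A$i$2 * B$2$j"
  by (simp add: matrix_matrix_mult_def sum_2)

lemma matrix_vector_mult_2_nth: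
  "((A::real^2^2) *v x)$i = A$i$1 * x$1 + A$i$2 * x$2"
  by (simp add: matrix_vector_mult_def sum_2)

lemma trace_2: "trace (A::real^2^2) = A$1$1 + A$2$2"
  by (simp add: trace_def sum_2)

lemma matrix_2_eq_iff:
  "(A::real^2^2) = B \<longleftrightarrow> A$1$1 = B$1$1 \<and> A$1$2 = B$1$2 \<and> A$2$1 = B$2$1 \<and> A$2$2 = B$2$2"
  by (auto simp: vec_eq_iff forall_2)

lemma mat_1_2_nth [simp]:
  "(mat 1 :: real^2^2)$1$1 = 1" "(mat 1 :: real^2^2)$1$2 = 0"
  "(mat 1 :: real^2^2)$2$1 = 0" "(mat 1 :: real^2^2)$2$2 = 1"
  by (auto simp: mat_def)

lemmas matrix_2_simps = matrix_2_eq_iff matrix_mult_2_nth matrix_vector_mult_2_nth trace_2 det_2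

text \<open>Serves as the inverse on SL(2,R). Its entries are linear in those of \<open>A\<close>,
  so limits pass through it without any discussion of invertibility.\<close>

definition adjugate2 :: "real^2^2 \<Rightarrow> real^2^2" where
  "adjugate2 A = vector [vector [A$2$2, - A$1$2], vector [- A$2$1, A$1$1]]"

lemma adjugate2_nth [simp]:
  "adjugate2 A $1$1 = A$2$2" "adjugate2 A $1$2 = - A$1$2"
  "adjugate2 A $2$1 = - A$2$1" "adjugate2 A $2$2 = A$1$1"
  by (simp_all add: adjugate2_def)

lemma mult_adjugate2:
  assumes "det A = 1"
  shows "A ** adjugate2 A = mat 1" "adjugate2 A ** A = mat 1"
  using assms by (auto simp: matrix_2_simps algebra_simps)

lemma right_inverse_eq_adjugate2:
  assumes "det A = 1" "A ** B = mat 1"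
  shows "B = adjugate2 A"
  using assms by (metis matrix_mul_assoc matrix_mul_lid matrix_mul_rid mult_adjugate2(2))

lemma tendsto_matrix_2_iff:
  fixes X :: "'b \<Rightarrow> real^2^2"
  shows "(X \<longlongrightarrow> L) F \<longleftrightarrow> ((\<lambda>k. X k$1$1) \<longlongrightarrow> L$1$1) F \<and> ((\<lambda>k. X k$1$2) \<longlongrightarrow> L$1$2) F
     \<and> ((\<lambda>k. X k$2$1) \<longlongrightarrow> L$2$1) F \<and> ((\<lambda>k. X k$2$2) \<longlongrightarrow> L$2$2) F"
proof
  assume R: "((\<lambda>k. X k$1$1) \<longlongrightarrow> L$1$1) F \<and> ((\<lambda>k. X k$1$2) \<longlongrightarrow> L$1$2) F
     \<and> ((\<lambda>k. X k$2$1) \<longlongrightarrow> L$2$1) F \<and> ((\<lambda>k. X k$2$2) \<longlongrightarrow> L$2$2) F"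
  have "((\<lambda>k. X k$i$j) \<longlongrightarrow> L$i$j) F" for i j
    using R exhaust_2[of i] exhaust_2[of j] by auto
  then show "(X \<longlongrightarrow> L) F"
    by (intro vec_tendstoI)
qed (intro conjI tendsto_vec_nth; assumption)

lemma tendsto_matrix_mult_2:
  fixes X Y :: "'b \<Rightarrow> real^2^2"
  assumes "(X \<longlongrightarrow> A) F" "(Y \<longlongrightarrow> B) F"
  shows "((\<lambda>k. X k ** Y k) \<longlongrightarrow> A ** B) F"
  unfolding tendsto_matrix_2_iff matrix_mult_2_nth
  by (intro conjI tendsto_intros assms)

lemma tendsto_matrix_vector_mult_2:
  fixes X :: "'b \<Rightarrow> real^2^2"
  assumes "(X \<longlongrightarrow> A) F"
  shows "((\<lambda>k. X k *v v) \<longlongrightarrow> A *v v) F"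
  by (intro vec_tendstoI) (unfold matrix_vector_mult_2_nth, intro tendsto_intros assms)

lemma tendsto_adjugate2:
  assumes "(X \<longlongrightarrow> A) F"
  shows "((\<lambda>k. adjugate2 (X k)) \<longlongrightarrow> adjugate2 A) F"
  unfolding tendsto_matrix_2_iff adjugate2_nth by (intro conjI tendsto_intros assms)

lemma tendsto_det_2:
  fixes X :: "'b \<Rightarrow> real^2^2"
  assumes "(X \<longlongrightarrow> A) F"
  shows "((\<lambda>k. det (X k)) \<longlongrightarrow> det A) F"
  unfolding det_2 by (intro tendsto_intros assms)

lemma tendsto_trace_2:
  fixes X :: "'b \<Rightarrow> real^2^2"
  assumes "(X \<longlongrightarrow> A) F"
  shows "((\<lambda>k. trace (X k)) \<longlongrightarrow> trace A) F"
  unfolding trace_2 by (intro tendsto_intros assms)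

section \<open>Powers of a matrix and their recurrence\<close>

primrec matpow :: "real^2^2 \<Rightarrow> nat \<Rightarrow> real^2^2" where
  "matpow A 0 = mat 1"
| "matpow A (Suc n) = A ** matpow A n"

lemma matpow_add: "matpow A (m + n) = matpow A m ** matpow A n"
  by (induction m) (simp_all add: matrix_mul_assoc)

lemma det_matpow: "det A = 1 \<Longrightarrow> det (matpow A n) = 1"
  by (induction n) (simp_all add: det_mul)

lemma matpow_diff:
  assumes "det A = 1" "m \<le> n"
  shows "matpow A (n - m) = matpow A n ** adjugate2 (matpow A m)"
proof -
  have "matpow A n = matpow A (n - m) ** matpow A m"
    using assms(2) by (metis le_add_diff_inverse2 matpow_add)
  then show ?thesis
    using mult_adjugate2[OF det_matpow[OF assms(1)]] by (metis matrix_mul_assoc matrix_mul_rid)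
qed

lemma matpow_mult_inverse:
  assumes "A ** B = mat 1"
  shows "matpow A n ** matpow B n = mat 1"
proof (induction n)
  case (Suc n)
  have "matpow B (Suc n) = matpow B n ** B"
    using matpow_add[of B n 1] by simp
  then have "matpow A (Suc n) ** matpow B (Suc n) = A ** (matpow A n ** matpow B n) ** B"
    by (simp add: matrix_mul_assoc)
  then show ?case
    using Suc assms by simp
qed simp

text \<open>Quotients of successive terms of a convergent subsequence of powers tend to the limit
  times its inverse; the limit is invertible because determinants converge. Strict monotonicity of
  the subsequence keeps the exponents positive.\<close>

lemma matpow_tendsto_mat_1:
  assumes "det B = 1" "bounded (range (matpow B))"
  obtains m where "\<And>k. m k \<ge> (1::nat)" "(\<lambda>k. matpow B (m k)) \<longlonglongrightarrow> mat 1"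
proof -
  obtain L r where r: "strict_mono (r :: nat \<Rightarrow> nat)" and L: "(matpow B \<circ> r) \<longlonglongrightarrow> L"
    using bounded_imp_convergent_subsequence[OF assms(2)] by blast
  have L0: "(\<lambda>k. matpow B (r k)) \<longlonglongrightarrow> L"
    using L by (simp add: comp_def)
  have L1: "(\<lambda>k. matpow B (r (Suc k))) \<longlonglongrightarrow> L"
    using LIMSEQ_Suc[OF L0] .
  have "det L = 1"
    using LIMSEQ_unique[OF tendsto_det_2[OF L0]] by (simp add: assms(1) det_matpow)
  then have "L ** adjugate2 L = mat 1"
    by (rule mult_adjugate2)
  with tendsto_matrix_mult_2[OF L1 tendsto_adjugate2[OF L0]]
  have "(\<lambda>k. matpow B (r (Suc k)) ** adjugate2 (matpow B (r k))) \<longlonglongrightarrow> mat 1"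
    by simp
  moreover have "r k < r (Suc k)" for k
    using r by (simp add: strict_mono_Suc_iff)
  ultimately show thesis
    by (intro that[of "\<lambda>k. r (Suc k) - r k"])
      (simp_all add: matpow_diff[OF assms(1)] less_imp_le Suc_leI)
qed

text \<open>By Cayley--Hamilton, the entries of the powers satisfy \<open>x (n + 2) = t * x (n + 1) - x n\<close>, where
  \<open>t\<close> is the trace; this recursion preserves a quadratic form which is definite when \<open>\<bar>t\<bar> < 2\<close>.\<close>

lemma bounded_matpow_elliptic:
  assumes "det B = 1" "elliptic B"
  shows "bounded (range (matpow B))"
proof -
  define t where "t = trace B"
  have t: "\<bar>t\<bar> < 2"
    using assms(2) by (simp add: elliptic_def t_def)
  have rec: "matpow B (Suc (Suc n)) = t *\<^sub>R matpow B (Suc n) - matpow B n" for n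
  proof -
    have "B ** B = t *\<^sub>R B - mat 1"
      using assms(1) by (simp add: matrix_2_simps t_def) algebra
    then have "B ** B ** matpow B n = (t *\<^sub>R B - mat 1) ** matpow B n"
      by simp
    then show ?thesis
      by (simp add: matrix_2_simps algebra_simps)
  qed
  have "\<exists>c. \<forall>n. \<bar>matpow B n $ i $ j\<bar> \<le> c" for i j
  proof -
    define x where "x n = matpow B n $ i $ j" for n
    define Q where "Q n = (x (Suc n))\<^sup>2 - t * x (Suc n) * x n + (x n)\<^sup>2" for n
    have x: "x (Suc (Suc n)) = t * x (Suc n) - x n" for n
      using rec[of n] by (simp add: x_def)
    have "Q (Suc n) = Q n" for n
      unfolding Q_def x by (simp add: power2_eq_square algebra_simps)
    then have Q: "Q n = Q 0" for n
      by (induction n) auto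
    have "(x n)\<^sup>2 \<le> Q 0 / (1 - \<bar>t\<bar> / 2)" for n
    proof -
      have "t * x (Suc n) * x n \<le> \<bar>t\<bar> * (\<bar>x (Suc n)\<bar> * \<bar>x n\<bar>)"
        by (metis abs_ge_self abs_mult mult.assoc)
      also have "\<dots> \<le> \<bar>t\<bar> * (((x (Suc n))\<^sup>2 + (x n)\<^sup>2) / 2)"
        using sum_squares_bound[of "\<bar>x (Suc n)\<bar>" "\<bar>x n\<bar>"] by (intro mult_left_mono) auto
      finally have "(1 - \<bar>t\<bar> / 2) * ((x (Suc n))\<^sup>2 + (x n)\<^sup>2) \<le> Q n"
        by (simp add: Q_def algebra_simps add_divide_distrib)
      moreover have "(1 - \<bar>t\<bar> / 2) * (x n)\<^sup>2 \<le> (1 - \<bar>t\<bar> / 2) * ((x (Suc n))\<^sup>2 + (x n)\<^sup>2)"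
        using t by (intro mult_left_mono) auto
      ultimately show ?thesis
        using t Q[of n] by (simp add: field_simps)
    qed
    then have "\<bar>x n\<bar> \<le> sqrt (Q 0 / (1 - \<bar>t\<bar> / 2))" for n
      by (metis real_sqrt_abs real_sqrt_le_iff)
    then show ?thesis
      unfolding x_def by blast
  qed
  then obtain c where c: "\<And>i j n. \<bar>matpow B n $ i $ j\<bar> \<le> c i j"
    by metis
  have "norm (matpow B n) \<le> (\<Sum>i\<in>UNIV. \<Sum>j\<in>UNIV. c i j)" for n
  proof -
    have "norm (matpow B n) \<le> (\<Sum>i\<in>UNIV. norm (matpow B n $ i))"
      unfolding norm_vec_def by (rule L2_set_le_sum) simp
    also have "\<dots> \<le> (\<Sum>i\<in>UNIV. \<Sum>j\<in>UNIV. \<bar>matpow B n $ i $ j\<bar>)"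
      by (intro sum_mono norm_le_l1_cart)
    also have "\<dots> \<le> (\<Sum>i\<in>UNIV. \<Sum>j\<in>UNIV. c i j)"
      by (intro sum_mono c)
    finally show ?thesis .
  qed
  then show ?thesis
    by (auto simp: bounded_iff)
qed

section \<open>Words and uniform hyperbolicity\<close>

text \<open>Words are lists of letters, not of matrices, so that cancellation can be read off from a
  formal inverse on letters.\<close>

definition word_prod :: "('a \<Rightarrow> real^2^2) \<Rightarrow> 'a list \<Rightarrow> real^2^2" where
  "word_prod M ws = foldr (\<lambda>s. (**) (M s)) ws (mat 1)"

lemma word_prod_Nil [simp]: "word_prod M [] = mat 1"
  and word_prod_Cons [simp]: "word_prod M (s # ws) = M s ** word_prod M ws"
  by (simp_all add: word_prod_def)

lemma word_prod_append: "word_prod M (us @ vs) = word_prod M us ** word_prod M vs"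
  by (induction us) (simp_all add: matrix_mul_assoc)

lemma matpow_word_prod: "matpow (word_prod M ws) n = word_prod M (concat (replicate n ws))"
  by (induction n) (simp_all add: word_prod_append)

lemma det_word_prod:
  assumes "\<And>s. det (M s) = 1"
  shows "det (word_prod M ws) = 1"
  by (induction ws) (simp_all add: det_mul assms)

lemma semigroup_generated_word:
  assumes "B \<in> semigroup_generated (range M)"
  obtains ws where "ws \<noteq> []" "B = word_prod M ws"
proof -
  from assms have "\<exists>ws. ws \<noteq> [] \<and> B = word_prod M ws"
  proof induction
    case (gen A)
    then obtain s where "A = M s"
      by auto
    then have "A = word_prod M [s]"
      by simp
    then show ?case
      by blast
  next
    case (mult A B)
    then show ?case
      by (metis append_is_Nil_conv word_prod_append)
  qed
  then show thesis
    using that by blast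
qed

lemma mat_prod_word: "mat_prod (\<lambda>k. M (g k)) n = word_prod M (map g [0..<n])"
  by (induction n) (simp_all add: word_prod_append)

text \<open>The sequence that repeats \<open>ws\<close> periodically has all powers of one word
  product among its partial products; this tests uniform hyperbolicity on a single semigroup
  element.\<close>

lemma map_nth_mod_upt:
  assumes "ws \<noteq> []"
  shows "map (\<lambda>k. ws ! (k mod length ws)) [0..<n * length ws] = concat (replicate n ws)"
proof (induction n)
  case (Suc n)
  have "map (\<lambda>k. ws ! (k mod length ws)) [n * length ws..<length ws + n * length ws]
      = map (\<lambda>k. ws ! (k mod length ws)) (map (\<lambda>k. k + n * length ws) [0..<length ws])"
    by (simp only: map_add_upt add_0)
  also have "\<dots> = map (\<lambda>k. ws ! k) [0..<length ws]"
    by simp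
  also have "\<dots> = ws"
    by (rule map_nth)
  finally have "map (\<lambda>k. ws ! (k mod length ws)) [0..<Suc n * length ws]
      = concat (replicate n ws) @ ws"
    using Suc by (simp add: upt_add_eq_append[of 0 "n * length ws" "length ws"] add.commute[of "length ws"])
  then show ?case
    by (metis concat.simps(2) concat_append concat.simps(1) append_Nil2 replicate_Suc
        replicate_append_same)
qed simp

text \<open>The imaginary part of the image is 1 / (c^2 + d^2), so the denominators cancel. The
  argument of \<open>arcosh\<close> equals half the sum of the squared entries; hence bounded
  matrices move the base point a bounded distance.\<close>

lemma hyp_dist_moebius_i:
  assumes "det B = 1"
  shows "hyp_dist (moebius_H B \<i>) \<i>
       = arcosh (1 + ((B$1$2 + B$2$1)\<^sup>2 + (B$1$1 - B$2$2)\<^sup>2) / 2)"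
proof -
  define a b c d where "a = B$1$1" and "b = B$1$2" and "c = B$2$1" and "d = B$2$2"
  define w where "w = complex_of_real c * \<i> + of_real d"
  define z where "z = (complex_of_real a * \<i> + of_real b) / w"
  have det: "a * d - b * c = 1"
    using assms by (simp add: det_2 a_def b_def c_def d_def)
  have "c \<noteq> 0 \<or> d \<noteq> 0"
    using det by auto
  then have w: "w \<noteq> 0" and cd: "c\<^sup>2 + d\<^sup>2 \<noteq> 0"
    by (auto simp: w_def complex_eq_iff)
  have nw: "(cmod w)\<^sup>2 = c\<^sup>2 + d\<^sup>2"
    by (simp add: w_def cmod_power2)
  have "Im z = (a * d - b * c) / (c\<^sup>2 + d\<^sup>2)"
    by (simp add: z_def w_def Im_divide)
  then have Im: "Im z = 1 / (c\<^sup>2 + d\<^sup>2)"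
    using det by simp
  have "z - \<i> = (of_real (b + c) + \<i> * of_real (a - d)) / w"
    using w by (simp add: z_def field_simps) (simp add: w_def algebra_simps)
  then have "(cmod (z - \<i>))\<^sup>2 = ((b + c)\<^sup>2 + (a - d)\<^sup>2) / (c\<^sup>2 + d\<^sup>2)"
    by (simp add: norm_divide power_divide nw) (simp add: cmod_power2)
  then have "(cmod (z - \<i>))\<^sup>2 / (2 * Im z * Im \<i>) = ((b + c)\<^sup>2 + (a - d)\<^sup>2) / 2"
    using cd by (simp add: Im)
  moreover have "moebius_H B \<i> = z"
    by (simp add: moebius_H_def z_def w_def a_def b_def c_def d_def)
  ultimately show ?thesis
    by (simp only: hyp_dist_def a_def b_def c_def d_def)
qed

text \<open>Repeating a word for \<open>B\<close> forever gives an admissible sequence, along which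
  the displacement grows at least linearly; bounded powers of \<open>B\<close> would bound
  it.\<close>

lemma uniformly_hyperbolic_unbounded:
  fixes A :: "real^2^2^'n"
  assumes A: "A \<in> hyperbolic_locus" and B: "B \<in> semigroup_generated (range (($) A))"
  shows "\<not> bounded (range (matpow B))"
proof
  assume "bounded (range (matpow B))"
  then obtain K where K: "\<And>n. norm (matpow B n) \<le> K"
    by (auto simp: bounded_iff)
  have "\<bar>matpow B n $ i $ j\<bar> \<le> K" for n i j
    using K[of n] component_le_norm_cart[of "matpow B n $ i" j] Finite_Cartesian_Product.norm_nth_le[of "matpow B n" i]
    by linarith
  note Kn = this
  have det: "det (A $ s) = 1" for s
    using A by (simp add: hyperbolic_locus_def SL2R_tuples_def SL2R_def)
  obtain c \<kappa> where c: "c > 0" and uh: "\<And>f n. (\<forall>k. f k \<in> range (($) A)) \<Longrightarrow> n \<ge> 1 \<Longrightarrow>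
      hyp_dist (moebius_H (mat_prod f n) \<i>) \<i> \<ge> c * real n - \<kappa>"
    using A unfolding hyperbolic_locus_def uniformly_hyperbolic_def by blast
  obtain ws where ws: "ws \<noteq> []" "B = word_prod (($) A) ws"
    using semigroup_generated_word[OF B] by blast
  define f where "f k = A $ (ws ! (k mod length ws))" for k
  have f: "mat_prod f (n * length ws) = matpow B n" for n
    unfolding f_def mat_prod_word[of "($) A" "\<lambda>k. ws ! (k mod length ws)"] ws(2) matpow_word_prod
      map_nth_mod_upt[OF ws(1)] ..
  define R where "R = arcosh (1 + ((K + K)\<^sup>2 + (K + K)\<^sup>2) / 2)"
  have "c * real n - \<kappa> \<le> R" if n: "n \<ge> 1" for n
  proof -
    have len: "n \<le> n * length ws" "1 \<le> n * length ws"
      using n ws(1) by (simp_all add: Suc_le_eq)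
    have "c * real n \<le> c * real (n * length ws)"
      using len(1) c by (intro mult_left_mono) (simp_all only: of_nat_le_iff less_imp_le)
    also have "\<dots> - \<kappa> \<le> hyp_dist (moebius_H (matpow B n) \<i>) \<i>"
      using uh[of f "n * length ws"] len(2) by (simp only: f) (simp add: f_def)
    also have "\<dots> = arcosh (1 + ((matpow B n$1$2 + matpow B n$2$1)\<^sup>2
        + (matpow B n$1$1 - matpow B n$2$2)\<^sup>2) / 2)"
      using ws det by (intro hyp_dist_moebius_i det_matpow) (simp add: det_word_prod)
    also have "\<dots> \<le> R"
    proof -
      have "(matpow B n$1$2 + matpow B n$2$1)\<^sup>2 \<le> (K + K)\<^sup>2"
        using Kn[of n 1 2] Kn[of n 2 1] by (intro abs_le_square_iff[THEN iffD1]) linarith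
      moreover have "(matpow B n$1$1 - matpow B n$2$2)\<^sup>2 \<le> (K + K)\<^sup>2"
        using Kn[of n 1 1] Kn[of n 2 2] by (intro abs_le_square_iff[THEN iffD1]) linarith
      ultimately show ?thesis
        unfolding R_def
        by (intro leI notI) (subst (asm) arcosh_less_iff_real, auto)
    qed
    finally show ?thesis
      by simp
  qed
  then have "c * real (Suc n) \<le> R + \<kappa>" for n
    by (simp only: diff_le_eq One_nat_def Suc_le_mono le0)
  moreover obtain n where "real n > (R + \<kappa>) / c"
    using reals_Archimedean2 by blast
  then have "R + \<kappa> < c * real n"
    using c by (simp add: field_simps)
  then have "R + \<kappa> < c * real (Suc n)"
    using c by (simp add: algebra_simps)
  ultimately show False
    by (meson not_le)
qed

lemma hyperbolic_locus_semigroup: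
  fixes A :: "real^2^2^'n"
  assumes A: "A \<in> hyperbolic_locus" and B: "B \<in> semigroup_generated (range (($) A))"
  shows "det B = 1" "\<not> elliptic B" "B \<noteq> mat 1"
proof -
  have "det (A $ s) = 1" for s
    using A by (simp add: hyperbolic_locus_def SL2R_tuples_def SL2R_def)
  then show det: "det B = 1"
    using semigroup_generated_word[OF B] by (metis det_word_prod)
  show "\<not> elliptic B"
    using bounded_matpow_elliptic[OF det] uniformly_hyperbolic_unbounded[OF A B] by blast
  have "matpow (mat 1) n = mat 1" for n
    by (induction n) simp_all
  then have "bounded (range (matpow (mat 1)))"
    by simp
  then show "B \<noteq> mat 1"
    using uniformly_hyperbolic_unbounded[OF A B] by blast
qed

section \<open>Ping-pong in the plane\<close>

text \<open>The sets live in the plane rather than on the circle, so linear maps and their limits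
  act on them directly. Disjointness is asked of the sets and not of their closures, because
  Schottky intervals may touch; openness makes maps near the identity keep a point inside its
  set.\<close>

locale ping_pong =
  fixes M :: "'a \<Rightarrow> real^2^2" and bar :: "'a \<Rightarrow> 'a" and I :: "'a \<Rightarrow> (real^2) set"
  assumes bar_bar [simp]: "bar (bar s) = s"
    and bar_neq: "bar s \<noteq> s"
    and det_M: "det (M s) = 1"
    and M_bar: "M s ** M (bar s) = mat 1"
    and open_I: "open (I s)"
    and I_nonempty: "I s \<noteq> {}"
    and I_disjoint: "s \<noteq> t \<Longrightarrow> I s \<inter> I t = {}"
    and M_maps: "t \<noteq> bar s \<Longrightarrow> v \<in> I t \<Longrightarrow> M s *v v \<in> I s"
begin

lemma M_bar': "M (bar s) ** M s = mat 1"
  using M_bar[of "bar s"] by simp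

text \<open>Read from the right: each letter pushes the vector into its own set, which the next
  letter accepts because the two are not inverse.\<close>

lemma reduced_word_maps:
  assumes "ws \<noteq> []" "successively (\<lambda>s t. t \<noteq> bar s) ws" "t \<noteq> bar (last ws)" "v \<in> I t"
  shows "word_prod M ws *v v \<in> I (hd ws)"
  using assms
proof (induction ws)
  case (Cons s ws)
  show ?case
  proof (cases "ws = []")
    case False
    with Cons have "word_prod M ws *v v \<in> I (hd ws)" "hd ws \<noteq> bar s"
      by (auto simp: successively_Cons)
    then show ?thesis
      using M_maps by (simp flip: matrix_vector_mul_assoc)
  qed (use Cons.prems M_maps in auto)
qed simp

text \<open>Maps close to the identity keep a point of the open set \<open>I t\<close> inside it,
  but the images lie in the disjoint set \<open>I s\<close>.\<close>

lemma not_tendsto_mat_1: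
  assumes "s \<noteq> t" and X: "\<And>k v. v \<in> I t \<Longrightarrow> X k *v v \<in> I s"
  shows "\<not> (X \<longlonglongrightarrow> mat 1)"
proof
  assume "X \<longlonglongrightarrow> mat 1"
  obtain v where v: "v \<in> I t"
    using I_nonempty by blast
  have "(\<lambda>k. X k *v v) \<longlonglongrightarrow> v"
    using tendsto_matrix_vector_mult_2[OF \<open>X \<longlonglongrightarrow> mat 1\<close>, of v] by simp
  then have "eventually (\<lambda>k. X k *v v \<in> I t) sequentially"
    using topological_tendstoD[OF _ open_I v] by blast
  then show False
    using X[OF v] I_disjoint[OF assms(1)] by (auto simp: eventually_sequentially)
qed

text \<open>A shortest elliptic word is cyclically reduced, so all its powers map a third set \<open>I t\<close> into
  \<open>I (hd ws)\<close>, although some of them are arbitrarily close to the identity.\<close>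

lemma not_elliptic_word_prod:
  assumes third: "\<And>a b :: 'a. \<exists>t. t \<noteq> a \<and> t \<noteq> b"
  shows "\<not> elliptic (word_prod M ws)"
proof (induction "length ws" arbitrary: ws rule: less_induct)
  case less
  show ?case
  proof (cases "ws = []")
    case True
    then show ?thesis
      by (simp add: elliptic_def trace_2)
  next
    case ws: False
    show ?thesis
    proof (cases "successively (\<lambda>s t. t \<noteq> bar s) ws")
      case False
      then obtain us vs s where s: "ws = us @ [s, bar s] @ vs"
        unfolding successively_conv_nth
        by (metis Cons_nth_drop_Suc Suc_lessD append_Cons append_Nil append_take_drop_id)
      have "M s ** (M (bar s) ** word_prod M vs) = word_prod M vs"
        by (simp add: matrix_mul_assoc M_bar)
      then have "word_prod M ws = word_prod M (us @ vs)"
        by (simp add: s word_prod_append)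
      with less[of "us @ vs"] show ?thesis
        by (simp add: s)
    next
      case red: True
      show ?thesis
      proof (cases "hd ws = bar (last ws)")
        case True
        define s where "s = last ws"
        \<comment> \<open>\<open>bar_neq\<close> excludes a one-letter word, so both end letters can
          be removed. This is a conjugation, and ellipticity depends only on the trace.\<close>
        from ws True bar_neq[of s] obtain mid where mid: "ws = bar s # mid @ [s]"
          unfolding s_def by (metis append_butlast_last_id last_ConsL list.collapse last_ConsR)
        have "trace (word_prod M ws) = trace (word_prod M mid ** M s ** M (bar s))"
          using trace_mul_sym[of "M (bar s)" "word_prod M mid ** M s"]
          by (simp add: mid word_prod_append)
        also have "\<dots> = trace (word_prod M mid)"
          by (metis M_bar matrix_mul_assoc matrix_mul_rid)
        finally show ?thesis
          using less[of mid] by (simp add: mid elliptic_def)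
      next
        case cyc: False
        \<comment> \<open>Avoiding \<open>bar (last ws)\<close> lets the word act on
          \<open>I t\<close>; avoiding \<open>hd ws\<close> makes the image disjoint from
          \<open>I t\<close>.\<close>
        obtain t where t: "t \<noteq> hd ws" "t \<noteq> bar (last ws)"
          using third by blast
        have maps: "matpow (word_prod M ws) (Suc n) *v v \<in> I (hd ws)" if "v \<in> I t" for n v
        proof (induction n)
          case 0
          show ?case
            using reduced_word_maps[OF ws red t(2) that] by simp
        next
          case (Suc n)
          then show ?case
            using reduced_word_maps[OF ws red cyc Suc] by (simp add: matrix_vector_mul_assoc)
        qed
        show ?thesis
        proof
          assume ell: "elliptic (word_prod M ws)"
          have det: "det (word_prod M ws) = 1"
            by (rule det_word_prod[of M, OF det_M])
          obtain m where m: "\<And>k. m k \<ge> (1::nat)" "(\<lambda>k. matpow (word_prod M ws) (m k)) \<longlonglongrightarrow> mat 1"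
            using matpow_tendsto_mat_1[OF det bounded_matpow_elliptic[OF det ell]] by blast
          have "matpow (word_prod M ws) (m k) *v v \<in> I (hd ws)" if "v \<in> I t" for k v
            using maps[OF that, of "m k - 1"] m(1)[of k] by (cases "m k") (simp_all del: matpow.simps)
          then show False
            using not_tendsto_mat_1[OF t(1)[symmetric], of "\<lambda>k. matpow (word_prod M ws) (m k)"] m(2)
            by blast
        qed
      qed
    qed
  qed
qed

lemma matpow_maps:
  assumes "t \<noteq> bar s" "v \<in> I t"
  shows "matpow (M s) (Suc n) *v v \<in> I s"
proof (induction n)
  case (Suc n)
  then show ?case
    using M_maps[OF bar_neq[of s, symmetric]] by (simp flip: matrix_vector_mul_assoc)
qed (use M_maps[OF assms] in simp)

text \<open>If \<open>X n = F^n H F^(-n)\<close> converged, then \<open>X n (X (n + 1))^(-1) = F^n H F H^(-1) F^(-n-1)\<close> would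
  tend to the identity, which contradicts the ping-pong dynamics.\<close>

lemma conjugates_not_convergent:
  assumes t: "t \<noteq> s" "t \<noteq> bar s"
  shows "\<not> ((\<lambda>n. matpow (M s) n ** M t ** matpow (M (bar s)) n) \<longlonglongrightarrow> L)"
proof
  define X where "X n = matpow (M s) n ** M t ** matpow (M (bar s)) n" for n
  define Y where "Y n = matpow (M s) n ** M t ** M s ** M (bar t) ** matpow (M (bar s)) (Suc n)" for n
  assume "(\<lambda>n. matpow (M s) n ** M t ** matpow (M (bar s)) n) \<longlonglongrightarrow> L"
  then have X: "X \<longlonglongrightarrow> L"
    by (simp add: X_def [abs_def])
  have detX: "det (X n) = 1" for n
    by (simp add: X_def det_mul det_matpow det_M)
  then have detL: "det L = 1"
    using LIMSEQ_unique[OF tendsto_det_2[OF X]] by simp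
  have cancel: "matpow (M (bar s)) n ** (matpow (M s) n ** Z) = Z" for n Z
    by (simp add: matrix_mul_assoc matpow_mult_inverse M_bar')
  have cancel_t: "M t ** (M (bar t) ** Z) = Z" for Z
    by (simp add: matrix_mul_assoc M_bar)
  have "X (Suc n) ** (matpow (M s) (Suc n) ** M (bar t) ** matpow (M (bar s)) (Suc n)) = mat 1" for n
    unfolding X_def matrix_mul_assoc[symmetric] cancel cancel_t
    by (rule matpow_mult_inverse[OF M_bar])
  then have adj: "adjugate2 (X (Suc n)) = matpow (M s) (Suc n) ** M (bar t) ** matpow (M (bar s)) (Suc n)" for n
    using right_inverse_eq_adjugate2[OF detX] by metis
  have pow: "matpow (M s) (Suc n) = matpow (M s) n ** M s" for n
    using matpow_add[of "M s" n 1] by simp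
  then have XY: "X n ** adjugate2 (X (Suc n)) = Y n" for n
    by (subst adj) (simp only: X_def Y_def pow matrix_mul_assoc[symmetric] cancel)
  have "(\<lambda>n. X n ** adjugate2 (X (Suc n))) \<longlonglongrightarrow> L ** adjugate2 L"
    by (intro tendsto_matrix_mult_2 tendsto_adjugate2 X LIMSEQ_Suc)
  then have Y: "Y \<longlonglongrightarrow> mat 1"
    by (simp add: XY mult_adjugate2[OF detL])
  have neq: "bar t \<noteq> s" "bar t \<noteq> bar s" "t \<noteq> bar s"
    using t by (metis bar_bar)+
  \<comment> \<open>The index is shifted because \<open>Y 0\<close> has no leading factor
    \<open>M s\<close> and maps \<open>I t\<close> into itself.\<close>
  have "Y (Suc n) *v v \<in> I s" if v: "v \<in> I t" for n v
  proof -
    have 1: "matpow (M (bar s)) (Suc (Suc n)) *v v \<in> I (bar s)" (is "?v1 \<in> _")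
      by (rule matpow_maps[OF _ v]) (simp add: t)
    have 2: "M (bar t) *v ?v1 \<in> I (bar t)" (is "?v2 \<in> _")
      by (rule M_maps[OF _ 1]) (simp add: neq(3)[symmetric])
    have 3: "M s *v ?v2 \<in> I s" (is "?v3 \<in> _")
      by (rule M_maps[OF neq(2) 2])
    have 4: "M t *v ?v3 \<in> I t"
      by (rule M_maps[OF neq(1)[symmetric] 3])
    have "matpow (M s) (Suc n) *v (M t *v ?v3) \<in> I s"
      by (rule matpow_maps[OF neq(3) 4])
    then show ?thesis
      by (simp only: Y_def matrix_vector_mul_assoc[symmetric])
  qed
  then show False
    using not_tendsto_mat_1[of s t "\<lambda>n. Y (Suc n)"] t LIMSEQ_Suc[OF Y] by auto
qed

end

text \<open>Change of basis, used to make one hyperbolic generator diagonal.\<close>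

lemma ping_pong_conjugate:
  assumes "ping_pong M bar I" "P ** Q = mat 1" "Q ** P = mat 1"
  shows "ping_pong (\<lambda>s. Q ** M s ** P) bar (\<lambda>s. (\<lambda>v. P *v v) -` I s)"
proof -
  interpret ping_pong M bar I by fact
  have PQ: "P *v (Q *v v) = v" "P ** (Q ** Z) = Z" for v and Z :: "real^2^2"
    using assms(2) by (simp_all add: matrix_vector_mul_assoc matrix_mul_assoc)
  show ?thesis
  proof
    fix s t v
    show "det (Q ** M s ** P) = 1"
      using det_mul[of P Q] assms(2) by (simp add: det_mul det_M mult.commute)
    have "Q ** M s ** P ** (Q ** M (bar s) ** P) = Q ** (M s ** M (bar s)) ** P"
      by (simp only: matrix_mul_assoc[symmetric] PQ)
    then show "Q ** M s ** P ** (Q ** M (bar s) ** P) = mat 1"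
      by (simp add: M_bar assms(3))
    show "open ((\<lambda>v. P *v v) -` I s)"
      by (intro open_vimage open_I matrix_vector_mult_linear_continuous_on)
    obtain u where "u \<in> I s"
      using I_nonempty by blast
    then have "Q *v u \<in> (\<lambda>v. P *v v) -` I s"
      by (simp add: PQ)
    then show "(\<lambda>v. P *v v) -` I s \<noteq> {}"
      by blast
    show "(\<lambda>v. P *v v) -` I s \<inter> (\<lambda>v. P *v v) -` I t = {}" if "s \<noteq> t"
      using I_disjoint[OF that] by blast
    show "Q ** M s ** P *v v \<in> (\<lambda>v. P *v v) -` I s" if "t \<noteq> bar s" "v \<in> (\<lambda>v. P *v v) -` I t"
      using M_maps[OF that(1), of "P *v v"] that(2) by (simp add: PQ flip: matrix_vector_mul_assoc)
  qed (simp_all add: bar_neq)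
qed

section \<open>Schottky generators\<close>

text \<open>Homogeneous coordinates on the circle, with the horizontal axis at infinity. The zero
  vector also gets the value \<open>None\<close>, which is why \<open>cone_over\<close> excludes
  it.\<close>

definition line_of :: "real^2 \<Rightarrow> real option" where
  "line_of v = (if v$2 = 0 then None else Some (v$1 / v$2))"

definition cone_over :: "real option set \<Rightarrow> (real^2) set" where
  "cone_over S = {v. v \<noteq> 0 \<and> line_of v \<in> S}"

lemma zero_notin_cone_over [simp]: "0 \<notin> cone_over S"
  by (simp add: cone_over_def)

lemma vec_2_eq_0_iff: "(v::real^2) = 0 \<longleftrightarrow> v$1 = 0 \<and> v$2 = 0"
  by (simp add: vec_eq_iff forall_2)

lemma cone_over_nonempty:
  assumes "S \<noteq> {}"
  shows "cone_over S \<noteq> {}"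
proof -
  obtain x where "x \<in> S"
    using assms by blast
  moreover have "line_of (vector [1, 0]) = None" "line_of (vector [y, 1]) = Some y"
    "(vector [1, 0] :: real^2) \<noteq> 0" "(vector [y, 1] :: real^2) \<noteq> 0" for y
    by (simp_all add: line_of_def vec_2_eq_0_iff)
  ultimately show ?thesis
    unfolding cone_over_def by (cases x) (metis (mono_tags, lifting) empty_iff mem_Collect_eq)+
qed

lemma moebius_R_line_of:
  assumes "v \<noteq> 0"
  shows "moebius_R M (line_of v) = line_of (M *v v)"
proof (cases "v$2 = 0")
  case True
  then show ?thesis
    using assms by (simp add: line_of_def matrix_vector_mult_2_nth vec_2_eq_0_iff)
next
  case False
  then have "M$i$1 * (v$1 / v$2) + M$i$2 = (M *v v)$i / v$2" for i
    by (simp add: matrix_vector_mult_2_nth field_simps)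
  then show ?thesis
    using False by (simp add: line_of_def)
qed

lemma open_cone_over:
  assumes "openin ext_real_line S"
  shows "open (cone_over S)"
proof -
  have quot: "open {v :: real^2. v$2 \<noteq> 0 \<and> v$1 / v$2 \<in> U}" if "open U" for U :: "real set"
  proof -
    have "open {v :: real^2. v$2 \<noteq> 0}"
      by (intro open_Collect_neq continuous_intros)
    moreover have "continuous_on {v :: real^2. v$2 \<noteq> 0} (\<lambda>v. v$1 / v$2)"
      by (intro continuous_intros) auto
    ultimately have "open ({v :: real^2. v$2 \<noteq> 0} \<inter> (\<lambda>v. v$1 / v$2) -` U)"
      using that by (intro continuous_open_preimage)
    then show ?thesis
      by (simp add: vimage_def Int_def)
  qed
  from assms consider U where "open U" "S = Some ` U"
    | C where "compact C" "closed C" "S = insert None (Some ` (UNIV - C))"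
    by (auto simp: openin_Alexandroff_compactification)
  then show ?thesis
  proof cases
    case 1
    then have "cone_over S = {v :: real^2. v$2 \<noteq> 0 \<and> v$1 / v$2 \<in> U}"
      by (auto simp: cone_over_def line_of_def split: if_splits)
    then show ?thesis
      using quot 1 by simp
  next
    case 2
    obtain R where R: "R > 0" "\<And>x. x \<in> C \<Longrightarrow> \<bar>x\<bar> \<le> R"
      using compact_imp_bounded[OF 2(1)] by (auto simp: bounded_pos)
    \<comment> \<open>Near infinity the cone is described by an inequality without division, which
      covers the horizontal axis and excludes the zero vector.\<close>
    have "cone_over S = {v :: real^2. v$2 \<noteq> 0 \<and> v$1 / v$2 \<in> - C} \<union> {v. \<bar>v$1\<bar> > R * \<bar>v$2\<bar>}"
      (is "_ = ?U \<union> ?V")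
    proof
      show "cone_over S \<subseteq> ?U \<union> ?V"
        by (auto simp: 2(3) cone_over_def line_of_def vec_2_eq_0_iff split: if_splits)
      have "v \<in> cone_over S" if v: "v \<in> ?V" for v
      proof (cases "v$2 = 0")
        case True
        then show ?thesis
          using v by (auto simp: 2(3) cone_over_def line_of_def vec_2_eq_0_iff)
      next
        case False
        then have "\<bar>v$1 / v$2\<bar> > R"
          using v by (simp add: field_simps)
        then have "v$1 / v$2 \<notin> C"
          using R(2) by force
        with False show ?thesis
          by (auto simp: 2(3) cone_over_def line_of_def)
      qed
      moreover have "v \<in> cone_over S" if "v \<in> ?U" for v
        using that by (auto simp: 2(3) cone_over_def line_of_def)
      ultimately show "?U \<union> ?V \<subseteq> cone_over S"
        by blast
    qed
    moreover have "open ?V"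
      by (intro open_Collect_less continuous_intros)
    ultimately show ?thesis
      using quot[of "- C"] 2(2) by (auto simp: open_Compl)
  qed
qed

lemma continuous_on_vec_2:
  fixes f g :: "'a::topological_space \<Rightarrow> real"
  assumes "continuous_on S f" "continuous_on S g"
  shows "continuous_on S (\<lambda>x. (\<chi> i. if i = 1 then f x else g x) :: real^2)"
proof (rule continuous_on_vec_lambda)
  show "continuous_on S (\<lambda>x. if i = 1 then f x else g x)" for i :: 2
    by (cases "i = 1") (simp_all add: assms)
qed

text \<open>A short segment through \<open>v\<close> transverse to its line meets all neighbouring
  lines. A neighbourhood of \<open>v\<close> missing the cone is therefore sliced horizontally, or
  vertically when \<open>v\<close> represents infinity, to give a neighbourhood on the circle
  missing \<open>A\<close>.\<close>

lemma line_of_notin_closure: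
  assumes "v \<noteq> 0" "v \<notin> closure (cone_over A)"
  shows "line_of v \<notin> ext_real_line closure_of A"
proof -
  define U where "U = - closure (cone_over A)"
  have U: "open U" "v \<in> U" "U \<inter> cone_over A = {}"
    using assms(2) closure_subset by (auto simp: U_def)
  have "\<exists>W. line_of v \<in> W \<and> openin ext_real_line W \<and> W \<inter> A = {}"
  proof (cases "v$2 = 0")
    case False
    define f where "f x = ((\<chi> i. if i = 1 then x * v$2 else v$2) :: real^2)" for x
    have "continuous_on UNIV f"
      unfolding f_def by (rule continuous_on_vec_2) (intro continuous_intros)+
    then have "open (f -` U)"
      using U(1) by (rule open_vimage[rotated])
    then have "openin ext_real_line (Some ` (f -` U))"
      by simp
    moreover have "f (v$1 / v$2) = v"
      using False by (simp add: f_def vec_eq_iff forall_2)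
    then have "line_of v \<in> Some ` (f -` U)"
      using U(2) False by (simp add: line_of_def)
    moreover have "f x \<in> cone_over A" if "Some x \<in> A" for x
      using that False by (simp add: f_def cone_over_def line_of_def vec_2_eq_0_iff)
    then have "Some ` (f -` U) \<inter> A = {}"
      using U(3) by auto
    ultimately show ?thesis
      by (intro exI[of _ "Some ` (f -` U)"] conjI)
  next
    case True
    then have v1: "v$1 \<noteq> 0"
      using assms(1) by (simp add: vec_2_eq_0_iff)
    define f where "f t = ((\<chi> i. if i = 1 then v$1 else t) :: real^2)" for t
    have cont: "continuous_on UNIV f"
      unfolding f_def by (rule continuous_on_vec_2) (intro continuous_intros)+
    have f0: "f 0 = v"
      using True by (simp add: f_def vec_eq_iff forall_2)
    have "open (f -` U)"
      using U(1) cont by (rule open_vimage)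
    moreover have "0 \<in> f -` U"
      using U(2) f0 by simp
    ultimately obtain \<delta> where "\<delta> > 0" "ball 0 \<delta> \<subseteq> f -` U"
      by (rule openE)
    then have \<delta>: "\<delta> > 0" "\<And>t. \<bar>t\<bar> < \<delta> \<Longrightarrow> f t \<in> U"
      by auto
    \<comment> \<open>On the vertical slice a finite point x is represented at height
      \<open>v$1 / x\<close>, which is below \<delta> in absolute value outside this
      interval.\<close>
    define C where "C = cball (0::real) (\<bar>v$1\<bar> / \<delta>)"
    have "openin ext_real_line (insert None (Some ` (UNIV - C)))"
      unfolding openin_Alexandroff_compactification
      by (rule disjI2, rule exI[of _ C]) (simp add: C_def)
    moreover have "None \<notin> A"
      using U assms(1) True by (auto simp: cone_over_def line_of_def)
    moreover have "Some x \<notin> A" if "x \<notin> C" for x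
    proof -
      have x: "\<bar>x\<bar> > \<bar>v$1\<bar> / \<delta>"
        using that by (simp add: C_def)
      moreover have "\<bar>v$1\<bar> / \<delta> \<ge> 0"
        using \<delta>(1) by simp
      ultimately have "\<bar>x\<bar> > 0"
        by linarith
      then have "x \<noteq> 0"
        by simp
      then have "\<bar>v$1 / x\<bar> < \<delta>"
        using x \<delta>(1) by (simp add: field_simps)
      then have "f (v$1 / x) \<in> U"
        by (rule \<delta>(2))
      moreover have "line_of (f (v$1 / x)) = Some x" "f (v$1 / x) \<noteq> 0"
        using v1 \<open>x \<noteq> 0\<close> by (simp_all add: f_def line_of_def vec_2_eq_0_iff)
      ultimately show ?thesis
        using U(3) by (auto simp: cone_over_def)
    qed
    ultimately show ?thesis
      using True by (intro exI[of _ "insert None (Some ` (UNIV - C))"]) (auto simp: line_of_def)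
  qed
  then show ?thesis
    by (auto simp: in_closure_of)
qed

lemma moebius_R_cone_over:
  assumes "moebius_R F ` (- (ext_real_line closure_of A)) \<subseteq> B" "det F = 1"
    and "v \<noteq> 0" "v \<notin> closure (cone_over A)"
  shows "F *v v \<in> cone_over B"
proof -
  have "F *v v \<noteq> 0"
    using assms(2,3) by (metis matrix_left_invertible_ker mult_adjugate2(2))
  moreover have "line_of (F *v v) \<in> B"
    using assms(1) line_of_notin_closure[OF assms(3,4)] moebius_R_line_of[OF assms(3), of F] by auto
  ultimately show ?thesis
    by (simp add: cone_over_def)
qed

text \<open>The map is x -> a - 1 / (x + d). It carries the outside of the interval of radius 1
  about its pole -d onto the inside of the one about a, the image of infinity.\<close>

lemma moebius_R_isometric_interval:
  assumes M: "M$1$1 = a" "M$1$2 = a * d - 1" "M$2$1 = 1" "M$2$2 = d"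
  shows "moebius_R M ` (- (Some ` {-d - 1..-d + 1})) = Some ` {a - 1<..<a + 1}"
proof (intro equalityI subsetI)
  fix y assume "y \<in> moebius_R M ` (- (Some ` {-d - 1..-d + 1}))"
  then obtain z where z: "z \<notin> Some ` {-d - 1..-d + 1}" "y = moebius_R M z"
    by auto
  show "y \<in> Some ` {a - 1<..<a + 1}"
  proof (cases z)
    case None
    then show ?thesis
      using z by (simp add: M)
  next
    case (Some x)
    then have x: "\<bar>x + d\<bar> > 1"
      using z(1) by (auto simp: image_iff)
    then have "x + d \<noteq> 0"
      by auto
    then have "y = Some (a - 1 / (x + d))"
      using Some z(2) by (simp add: M field_simps)
    moreover have "\<bar>1 / (x + d)\<bar> < 1"
      using x by simp
    then have "a - 1 / (x + d) \<in> {a - 1<..<a + 1}"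
      unfolding greaterThanLessThan_iff by linarith
    ultimately show ?thesis
      by blast
  qed
next
  fix y assume "y \<in> Some ` {a - 1<..<a + 1}"
  then obtain u where u: "y = Some u" "\<bar>u - a\<bar> < 1"
    by auto
  show "y \<in> moebius_R M ` (- (Some ` {-d - 1..-d + 1}))"
  proof (cases "u = a")
    case True
    then have "y = moebius_R M None"
      using u by (simp add: M)
    then show ?thesis
      by blast
  next
    case False
    define x where "x = - d + 1 / (a - u)"
    have xd: "x + d = 1 / (a - u)"
      by (simp add: x_def)
    have "\<bar>1 / (a - u)\<bar> > 1"
      using u False by (simp add: abs_minus_commute)
    then have "x \<notin> {-d - 1..-d + 1}"
      unfolding xd[symmetric] atLeastAtMost_iff by linarith
    moreover have "y = moebius_R M (Some x)"
      using False u(1) by (simp add: M xd) (simp add: x_def field_simps)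
    ultimately show ?thesis
      by blast
  qed
qed

lemma open_interval_Some:
  assumes "a < b"
  shows "open_interval (Some ` {a<..<b})"
proof -
  have "connectedin ext_real_line (Some ` {a<..<b})"
    by (rule connectedin_continuous_map_image[OF continuous_map_Some])
      (simp add: connectedin_iff_connected)
  moreover have "None \<notin> Some ` {a<..<b}"
    by auto
  ultimately show ?thesis
    using assms unfolding open_interval_def by (auto simp del: not_None_eq)
qed

lemma closure_of_Some_interval:
  assumes "a < b"
  shows "ext_real_line closure_of (Some ` {a<..<b}) = Some ` {a..b}"
proof (rule antisym)
  show "ext_real_line closure_of (Some ` {a<..<b}) \<subseteq> Some ` {a..b}"
    by (rule closure_of_minimal) auto
  have "Some ` (euclideanreal closure_of {a<..<b}) \<subseteq> ext_real_line closure_of (Some ` {a<..<b})"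
    using continuous_map_Some[of euclideanreal]
    unfolding continuous_map_eq_image_closure_subset image_subset_iff_funcset by (rule spec)
  then show "Some ` {a..b} \<subseteq> ext_real_line closure_of (Some ` {a<..<b})"
    using assms by simp
qed

text \<open>The intervals of radius 1 about -2 and 2 for \<open>F\<close>, and about 5 and 8 for
  \<open>H\<close>, are pairwise disjoint; the traces are 4 and 3, and the upper right entries are
  forced by the determinant.\<close>

lemma schottky_example:
  fixes F H :: "real^2^2"
  defines "F \<equiv> vector [vector [2, 3], vector [1, 2]]"
    and "H \<equiv> vector [vector [8, -41], vector [1, -5]]"
  shows "F \<in> SL2R" "H \<in> SL2R" "hyperbolic F" "hyperbolic H"
    and "standard_schottky_generating_set {moebius_R F, moebius_R H}"
proof -
  show "F \<in> SL2R" "H \<in> SL2R" "hyperbolic F" "hyperbolic H"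
    by (simp_all add: F_def H_def SL2R_def det_2 hyperbolic_def trace_2)
  have F: "moebius_R F ` (- (Some ` {-3..-1})) = Some ` {1<..<3}"
    using moebius_R_isometric_interval[of F 2 2] by (simp add: F_def)
  have H: "moebius_R H ` (- (Some ` {4..6})) = Some ` {7<..<9}"
    using moebius_R_isometric_interval[of H 8 "-5"] by (simp add: H_def)
  show "standard_schottky_generating_set {moebius_R F, moebius_R H}"
    unfolding standard_schottky_generating_set_def
    by (intro exI[of _ "moebius_R F"] exI[of _ "moebius_R H"]
        exI[of _ "Some ` {-3<..<-1::real}"] exI[of _ "Some ` {1<..<3::real}"]
        exI[of _ "Some ` {4<..<6::real}"] exI[of _ "Some ` {7<..<9::real}"])
      (auto simp: open_interval_Some closure_of_Some_interval F H disjnt_iff)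
qed


text \<open>The set where \<open>F\<close> takes values outside \<open>closure B\<close> replaces \<open>A\<close>: unlike \<open>A\<close> it
  visibly contains the images of the other sets under the inverse of \<open>F\<close>.\<close>

definition pulled_back :: "real^2^2 \<Rightarrow> (real^2) set \<Rightarrow> (real^2) set" where
  "pulled_back F B = {v. v \<noteq> 0 \<and> F *v v \<notin> closure B}"

lemma open_pulled_back: "open (pulled_back F B)"
proof -
  have "open ((\<lambda>v. F *v v) -` (- closure B))"
    by (intro open_vimage matrix_vector_mult_linear_continuous_on) auto
  moreover have "pulled_back F B = (\<lambda>v. F *v v) -` (- closure B) \<inter> - {0}"
    by (auto simp: pulled_back_def)
  ultimately show ?thesis
    by auto
qed

text \<open>An open set disjoint from \<open>B\<close> also misses its closure, so touching
  intervals do no harm.\<close>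

lemma inverse_maps_to_pulled_back:
  assumes "F ** F' = mat 1" "open X" "0 \<notin> X" "X \<inter> B = {}" "v \<in> X"
  shows "F' *v v \<in> pulled_back F B"
proof -
  have "F *v (F' *v v) = v"
    using assms(1) by (simp add: matrix_vector_mul_assoc)
  moreover have "v \<notin> closure B" "v \<noteq> 0"
    using open_Int_closure_eq_empty[OF assms(2)] assms(3-5) by auto
  ultimately show ?thesis
    by (auto simp: pulled_back_def)
qed

lemma pulled_back_disjoint:
  assumes "\<And>v. v \<noteq> 0 \<Longrightarrow> v \<notin> closure A \<Longrightarrow> F *v v \<in> B" "open X" "X \<inter> A = {}"
  shows "pulled_back F B \<inter> X = {}"
proof -
  have "pulled_back F B \<subseteq> closure A"
    using assms(1) closure_subset[of B] unfolding pulled_back_def by blast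
  then show ?thesis
    using open_Int_closure_eq_empty[OF assms(2)] assms(3) by blast
qed

section \<open>Ping-pong sets for the four letters of a Schottky pair\<close>

definition inverse_letter :: "4 \<Rightarrow> 4" where
  "inverse_letter i = (if i = 1 then 2 else if i = 2 then 1 else if i = 3 then 4 else 3)"

lemma inverse_letter_simps [simp]:
  "inverse_letter 1 = 2" "inverse_letter 2 = 1" "inverse_letter 3 = 4" "inverse_letter 4 = 3"
  by (simp_all add: inverse_letter_def)

lemma mult_matrix_inv_2:
  assumes "det (A::real^2^2) = 1"
  shows "A ** matrix_inv A = mat 1" "matrix_inv A ** A = mat 1"
  using someI[of "\<lambda>B. A ** B = mat 1 \<and> B ** A = mat 1" "adjugate2 A"] mult_adjugate2[OF assms]
  by (simp_all add: matrix_inv_def)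

lemma vector_4 [simp]:
  "(vector [w, x, y, z] :: 'a::zero^4)$1 = w" "(vector [w, x, y, z] :: 'a::zero^4)$2 = x"
  "(vector [w, x, y, z] :: 'a::zero^4)$3 = y" "(vector [w, x, y, z] :: 'a::zero^4)$4 = z"
  by (simp_all add: vector_def)

lemma schottky_ping_pong:
  fixes F H :: "real^2^2"
  assumes det: "det F = 1" "det H = 1"
    and op: "openin ext_real_line A" "openin ext_real_line B" "openin ext_real_line C" "openin ext_real_line D"
    and ne: "A \<noteq> {}" "B \<noteq> {}" "C \<noteq> {}" "D \<noteq> {}"
    and disj: "disjnt A B" "disjnt A C" "disjnt A D" "disjnt B C" "disjnt B D" "disjnt C D"
    and F: "moebius_R F ` (- (ext_real_line closure_of A)) = B"
    and H: "moebius_R H ` (- (ext_real_line closure_of C)) = D"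
  shows "\<exists>I. ping_pong (($) (vector [F, matrix_inv F, H, matrix_inv H] :: real^2^2^4)) inverse_letter I"
proof -
  define A0 B0 C0 D0 where "A0 = cone_over A" and "B0 = cone_over B" and "C0 = cone_over C" and "D0 = cone_over D"
  define A1 C1 where "A1 = pulled_back F B0" and "C1 = pulled_back H D0"
  have inv: "F ** matrix_inv F = mat 1" "matrix_inv F ** F = mat 1"
      "H ** matrix_inv H = mat 1" "matrix_inv H ** H = mat 1"
    by (rule mult_matrix_inv_2[OF det(1)] mult_matrix_inv_2[OF det(2)])+
  have det_inv: "det (matrix_inv F) = 1" "det (matrix_inv H) = 1"
    using inv det det_mul[of F "matrix_inv F"] det_mul[of H "matrix_inv H"] by simp_all
  have open0: "open A0" "open B0" "open C0" "open D0"
    unfolding A0_def B0_def C0_def D0_def by (intro open_cone_over op)+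
  have open1: "open A1" "open C1"
    unfolding A1_def C1_def by (rule open_pulled_back)+
  have zero: "0 \<notin> A0" "0 \<notin> B0" "0 \<notin> C0" "0 \<notin> D0" "0 \<notin> A1" "0 \<notin> C1"
    by (simp_all add: A0_def B0_def C0_def D0_def A1_def C1_def pulled_back_def)
  have F_maps: "F *v v \<in> B0" if "v \<noteq> 0" "v \<notin> closure A0" for v
    unfolding B0_def using that F det by (intro moebius_R_cone_over[of F A]) (auto simp: A0_def)
  have H_maps: "H *v v \<in> D0" if "v \<noteq> 0" "v \<notin> closure C0" for v
    unfolding D0_def using that H det by (intro moebius_R_cone_over[of H C]) (auto simp: C0_def)
  have ne0: "B0 \<noteq> {}" "D0 \<noteq> {}"
    using ne(2,4) by (simp_all add: B0_def D0_def cone_over_nonempty)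
  have disj0: "A0 \<inter> B0 = {}" "A0 \<inter> C0 = {}" "A0 \<inter> D0 = {}" "B0 \<inter> C0 = {}" "B0 \<inter> D0 = {}" "C0 \<inter> D0 = {}"
    using disj by (auto simp: A0_def B0_def C0_def D0_def cone_over_def disjnt_iff)
  have A1: "A1 \<inter> X = {}" if "open X" "X \<inter> A0 = {}" for X
    unfolding A1_def by (rule pulled_back_disjoint[OF F_maps that])
  have C1: "C1 \<inter> X = {}" if "open X" "X \<inter> C0 = {}" for X
    unfolding C1_def by (rule pulled_back_disjoint[OF H_maps that])
  have disj1: "A1 \<inter> B0 = {}" "A1 \<inter> C0 = {}" "A1 \<inter> D0 = {}" "C1 \<inter> A0 = {}" "C1 \<inter> B0 = {}" "C1 \<inter> D0 = {}"
    using disj0 by (intro A1 C1 open0; auto)+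
  \<comment> \<open>\<open>A1\<close> is itself an open set missing \<open>C0\<close>, so the
    disjointness principle for \<open>C1\<close> applies to it.\<close>
  have disj2: "A1 \<inter> C1 = {}"
    using C1[OF open1(1) disj1(2)] by auto
  have F'_maps: "matrix_inv F *v v \<in> A1" if "open X" "0 \<notin> X" "X \<inter> B0 = {}" "v \<in> X" for v X
    unfolding A1_def by (rule inverse_maps_to_pulled_back[OF inv(1) that])
  have H'_maps: "matrix_inv H *v v \<in> C1" if "open X" "0 \<notin> X" "X \<inter> D0 = {}" "v \<in> X" for v X
    unfolding C1_def by (rule inverse_maps_to_pulled_back[OF inv(3) that])
  have F_maps': "F *v v \<in> B0" if "open X" "0 \<notin> X" "X \<inter> A0 = {}" "v \<in> X" for v X
    using open_Int_closure_eq_empty[OF that(1)] that by (intro F_maps) auto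
  have H_maps': "H *v v \<in> D0" if "open X" "0 \<notin> X" "X \<inter> C0 = {}" "v \<in> X" for v X
    using open_Int_closure_eq_empty[OF that(1)] that by (intro H_maps) auto
  have ne1: "A1 \<noteq> {}" "C1 \<noteq> {}"
    using ne0 F'_maps[OF open0(4) zero(4)] H'_maps[OF open0(2) zero(2)] disj0 by blast+
  define I where "I i = (if i = 1 then B0 else if i = 2 then A1 else if i = 3 then D0 else C1)" for i :: 4
  have I: "I 1 = B0" "I 2 = A1" "I 3 = D0" "I 4 = C1"
    by (simp_all add: I_def)
  define T where "T = (vector [F, matrix_inv F, H, matrix_inv H] :: real^2^2^4)"
  have T: "T $ 1 = F" "T $ 2 = matrix_inv F" "T $ 3 = H" "T $ 4 = matrix_inv H"
    by (simp_all add: T_def vector_4)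
  have "ping_pong (($) T) inverse_letter I"
  proof
    show "inverse_letter (inverse_letter s) = s" "inverse_letter s \<noteq> s"
      "open (I s)" "I s \<noteq> {}" for s
      using exhaust_4[of s] by (auto simp: I open0 open1 ne0 ne1)
    show "det (T $ s) = 1" for s :: 4
      using exhaust_4[of s] by (auto simp: T det det_inv)
    show "T $ s ** T $ inverse_letter s = mat 1" for s :: 4
      using exhaust_4[of s] by (auto simp: T inv)
    show "I s \<inter> I t = {}" if "s \<noteq> t" for s t
      using exhaust_4[of s] exhaust_4[of t] that disj0 disj1 disj2 by (auto simp: I)
    show "T $ s *v v \<in> I s"
      if "t \<noteq> inverse_letter s" "v \<in> I t" for s t v
    proof -
      have "open (I t)" "0 \<notin> I t"
        using exhaust_4[of t] by (auto simp: I open0 open1 zero)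
      moreover have "s = 1 \<Longrightarrow> I t \<inter> A0 = {}" "s = 2 \<Longrightarrow> I t \<inter> B0 = {}"
          "s = 3 \<Longrightarrow> I t \<inter> C0 = {}" "s = 4 \<Longrightarrow> I t \<inter> D0 = {}"
        using exhaust_4[of t] that(1) disj0 disj1 by (auto simp: I)
      ultimately show ?thesis
        using exhaust_4[of s] that(2) F_maps' F'_maps H_maps' H'_maps by (elim disjE) (simp_all add: I T)
    qed
  qed
  then show ?thesis
    unfolding T_def by blast
qed

section \<open>Limits of tuples without elliptic products\<close>

lemma hyperbolic_diagonalizable:
  assumes "det F = 1" "hyperbolic F"
  obtains P Q :: "real^2^2" and l where "P ** Q = mat 1" "Q ** P = mat 1" "\<bar>l\<bar> > 1"
    "(Q ** F ** P)$1$1 = l" "(Q ** F ** P)$1$2 = 0" "(Q ** F ** P)$2$1 = 0" "(Q ** F ** P)$2$2 = 1 / l"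
proof -
  define a b c d where "a = F$1$1" and "b = F$1$2" and "c = F$2$1" and "d = F$2$2"
  define t where "t = a + d"
  have t: "\<bar>t\<bar> > 2" and det: "a * d - b * c = 1"
    using assms by (simp_all add: hyperbolic_def trace_2 det_2 t_def a_def b_def c_def d_def)
  have t4: "t\<^sup>2 - 4 > 0"
    using power_strict_mono[of 2 "\<bar>t\<bar>" 2] t by simp
  define q where "q = sqrt (t\<^sup>2 - 4)"
  have q: "q > 0" "q\<^sup>2 = t\<^sup>2 - 4"
    using t4 by (simp_all add: q_def)
  \<comment> \<open>The sign selects the eigenvalue of larger absolute value; the other one is its
    reciprocal.\<close>
  define l where "l = (t + sgn t * q) / 2"
  define m where "m = t - l"
  have "(sgn t)\<^sup>2 = 1"
    using t by (auto simp: sgn_if)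
  then have "(sgn t * q)\<^sup>2 = t\<^sup>2 - 4"
    using q(2) by (simp add: power_mult_distrib)
  then have lm: "l * m = 1"
    unfolding m_def l_def by (simp add: power2_eq_square field_simps)
  have "\<bar>l\<bar> = (\<bar>t\<bar> + q) / 2"
    using t q(1) by (auto simp: l_def sgn_if abs_if field_simps)
  then have l: "\<bar>l\<bar> > 1"
    using add_strict_mono[OF t q(1)] by simp
  have m: "m = 1 / l"
    using lm l by (auto simp: field_simps)
  have "l \<noteq> m"
  proof
    assume "l = m"
    then show False
      using lm l by (auto simp: square_eq_1_iff)
  qed
  have char: "l * (a + d - l) = 1" "m * (a + d - m) = 1"
    using lm by (simp_all add: m_def t_def mult.commute)
  have sum: "l + m = a + d"
    by (simp add: m_def t_def)
  obtain P where P: "det P \<noteq> 0" "(F ** P)$1$1 = l * P$1$1" "(F ** P)$2$1 = l * P$2$1"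
      "(F ** P)$1$2 = m * P$1$2" "(F ** P)$2$2 = m * P$2$2"
  proof -
    \<comment> \<open>The columns of \<open>P\<close> are eigenvectors. The choice (b, l - a), (b, m
      - a) is singular when b = 0, and (l - d, c), (m - d, c) when c = 0; if both vanish,
      \<open>F\<close> is diagonal and only the order of the eigenvalues is in question.\<close>
    consider "b \<noteq> 0" | "c \<noteq> 0" | "b = 0" "c = 0"
      by blast
    then show thesis
    proof cases
      case 1
      show ?thesis
        using 1 \<open>l \<noteq> m\<close> char det
        by (intro that[of "vector [vector [b, b], vector [l - a, m - a]]"])
          (simp_all add: det_2 matrix_mult_2_nth flip: a_def b_def c_def d_def, (simp add: algebra_simps; fail | algebra)+)
    next
      case 2
      show ?thesis
        using 2 \<open>l \<noteq> m\<close> char det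
        by (intro that[of "vector [vector [l - d, m - d], vector [c, c]]"])
          (simp_all add: det_2 matrix_mult_2_nth flip: a_def b_def c_def d_def, (simp add: algebra_simps; fail | algebra)+)
    next
      case 3
      then have "(l - a) * (l - d) = 0"
        using char(1) det by algebra
      then consider "l = a" "m = d" | "l = d" "m = a"
        using sum by auto
      then show ?thesis
      proof cases
        case 1
        then show ?thesis
          using 3 by (intro that[of "mat 1"])
            (simp_all add: det_2 matrix_mult_2_nth flip: a_def b_def c_def d_def)
      next
        case 2
        then show ?thesis
          using 3 by (intro that[of "vector [vector [0, 1], vector [1, 0]]"])
            (simp_all add: det_2 matrix_mult_2_nth flip: a_def b_def c_def d_def)
      qed
    qed
  qed
  define Q where "Q = (1 / det P) *\<^sub>R adjugate2 P"
  have "Q ** P = (1 / det P) *\<^sub>R (adjugate2 P ** P)" "P ** Q = (1 / det P) *\<^sub>R (P ** adjugate2 P)"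
    by (simp_all add: Q_def matrix_2_eq_iff matrix_mult_2_nth algebra_simps)
  moreover have "adjugate2 P ** P = det P *\<^sub>R mat 1" "P ** adjugate2 P = det P *\<^sub>R mat 1"
    by (simp_all add: matrix_2_simps algebra_simps)
  ultimately have QP: "Q ** P = mat 1" "P ** Q = mat 1"
    using P(1) by simp_all
  define E where "E = (vector [vector [l, 0], vector [0, m]] :: real^2^2)"
  have "F ** P = P ** E"
    using P(2-5) by (simp add: E_def matrix_2_eq_iff matrix_mult_2_nth[of P] mult.commute)
  then have "Q ** F ** P = E"
    using QP by (metis matrix_mul_assoc matrix_mul_lid)
  then show thesis
    using that[OF QP(2,1) l] by (simp add: E_def m)
qed

text \<open>Conjugation by the n-th power of the diagonal matrix scales one off-diagonal entry by
  l^(2n) and the other by l^(-2n). Were the growing entry zero, the conjugates would converge.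
  Geometrically, \<open>M t\<close> fixes neither eigenline of \<open>M s\<close>.\<close>

lemma (in ping_pong) off_diagonal_nonzero:
  assumes M: "M s$1$1 = l" "M s$1$2 = 0" "M s$2$1 = 0" "M s$2$2 = 1 / l" and l: "\<bar>l\<bar> > 1"
    and t: "t \<noteq> s" "t \<noteq> bar s"
  shows "M t$1$2 \<noteq> 0" "M t$2$1 \<noteq> 0"
proof -
  have M': "M (bar s) = adjugate2 (M s)"
    by (rule right_inverse_eq_adjugate2[OF det_M M_bar])
  have l0: "l \<noteq> 0"
    using l by auto
  have p: "matpow (M s) n$1$1 = l ^ n" "matpow (M s) n$1$2 = 0" "matpow (M s) n$2$1 = 0"
      "matpow (M s) n$2$2 = 1 / l ^ n" for n
    by (induction n) (simp_all add: matrix_mult_2_nth M)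
  have p': "matpow (M (bar s)) n$1$1 = 1 / l ^ n" "matpow (M (bar s)) n$1$2 = 0"
      "matpow (M (bar s)) n$2$1 = 0" "matpow (M (bar s)) n$2$2 = l ^ n" for n
    by (induction n) (simp_all add: matrix_mult_2_nth M M')
  have lim: "(\<lambda>n. x / (l ^ n * l ^ n)) \<longlonglongrightarrow> 0" for x
  proof -
    have "(\<lambda>n. inverse l ^ n) \<longlonglongrightarrow> 0"
      using l by (intro LIMSEQ_power_zero) (simp add: inverse_less_1_iff)
    then have "(\<lambda>n. x * (inverse l ^ n * inverse l ^ n)) \<longlonglongrightarrow> x * (0 * 0)"
      by (intro tendsto_mult tendsto_const)
    then show ?thesis
      by (simp add: power_inverse divide_inverse)
  qed
  show "M t$1$2 \<noteq> 0"
  proof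
    assume "M t$1$2 = 0"
    then have "(\<lambda>n. matpow (M s) n ** M t ** matpow (M (bar s)) n)
        \<longlonglongrightarrow> vector [vector [M t$1$1, 0], vector [0, M t$2$2]]"
      using lim[of "M t$2$1"] l0 by (simp add: tendsto_matrix_2_iff matrix_mult_2_nth p p')
    then show False
      using conjugates_not_convergent[OF t] by blast
  qed
  have t': "t \<noteq> bar (bar s)"
    using t by simp
  show "M t$2$1 \<noteq> 0"
  proof
    assume "M t$2$1 = 0"
    then have "(\<lambda>n. matpow (M (bar s)) n ** M t ** matpow (M (bar (bar s))) n)
        \<longlonglongrightarrow> vector [vector [M t$1$1, 0], vector [0, M t$2$2]]"
      using lim[of "M t$1$2"] l0 by (simp add: tendsto_matrix_2_iff matrix_mult_2_nth p p')
    then show False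
      using conjugates_not_convergent[OF t(2) t'] by blast
  qed
qed

text \<open>Conjugating \<open>w\<close> by large powers of \<open>F\<close> makes its upper right entry dominant. The resulting
  almost nilpotent matrix and its conjugate by \<open>H\<close> then have a sum of positive determinant, unless
  that entry vanishes.\<close>

lemma invariant_cone_trivial_diagonal:
  fixes K :: "(real^2^2) set"
  assumes F: "F$1$1 = l" "F$1$2 = 0" "F$2$1 = 0" "F$2$2 = 1 / l" and l: "\<bar>l\<bar> > 1"
    and H: "det H = 1" "H$1$2 \<noteq> 0" "H$2$1 \<noteq> 0" "trace H \<noteq> 0"
    and add: "\<And>u v. u \<in> K \<Longrightarrow> v \<in> K \<Longrightarrow> u + v \<in> K"
    and conj_F: "\<And>w. w \<in> K \<Longrightarrow> F ** w ** adjugate2 F \<in> K"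
    and conj_H: "\<And>w. w \<in> K \<Longrightarrow> H ** w ** adjugate2 H \<in> K"
    and conj_H': "\<And>w. w \<in> K \<Longrightarrow> adjugate2 H ** w ** H \<in> K"
    and trace: "\<And>w. w \<in> K \<Longrightarrow> trace w = 0"
    and det: "\<And>w. w \<in> K \<Longrightarrow> det w \<le> 0"
    and w: "w \<in> K"
  shows "w = 0"
proof -
  have l0: "l \<noteq> 0"
    using l by auto
  have b: "w$1$2 = 0" if w: "w \<in> K" for w
  proof -
    define r where "r n = inverse (l ^ n * l ^ n)" for n
    have r0: "r n \<noteq> 0" for n
      using l0 by (simp add: r_def)
    \<comment> \<open>\<open>V (r n)\<close> is \<open>r n\<close> times the n-th conjugate of
      \<open>w\<close>. The factor lets the family extend to 0, where only the upper right entry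
      survives.\<close>
    define V where "V x = (vector [vector [x * w$1$1, w$1$2], vector [x * x * w$2$1, x * w$2$2]] :: real^2^2)" for x
    have "(1 / r n) *\<^sub>R V (r n) \<in> K" for n
    proof (induction n)
      case 0
      have "(1 / r 0) *\<^sub>R V (r 0) = w"
        by (simp add: r_def V_def matrix_2_eq_iff)
      then show ?case
        using w by simp
    next
      case (Suc n)
      have "(1 / r (Suc n)) *\<^sub>R V (r (Suc n)) = F ** ((1 / r n) *\<^sub>R V (r n)) ** adjugate2 F"
        using l0 by (simp add: r_def V_def matrix_2_eq_iff matrix_mult_2_nth F field_simps)
      then show ?case
        using conj_F[OF Suc] by simp
    qed
    then have le1: "det ((1 / r n) *\<^sub>R V (r n) + H ** ((1 / r n) *\<^sub>R V (r n)) ** adjugate2 H) \<le> 0" for n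
      by (intro det add conj_H)
    \<comment> \<open>\<open>K\<close> need not be closed under scaling, but the sign of the
      determinant survives rescaling because it is homogeneous of degree 2.\<close>
    have eq: "det ((1 / r n) *\<^sub>R V (r n) + H ** ((1 / r n) *\<^sub>R V (r n)) ** adjugate2 H)
        = det (V (r n) + H ** V (r n) ** adjugate2 H) / (r n * r n)" for n
      using r0[of n] by (simp add: det_2 matrix_mult_2_nth field_simps)
    have le: "det (V (r n) + H ** V (r n) ** adjugate2 H) \<le> 0" for n
    proof -
      have "r n * r n > 0"
        using r0[of n] by (metis not_real_square_gt_zero)
      then show ?thesis
        using le1[of n]
        unfolding eq[of n] by (simp only: divide_le_0_iff) linarith
    qed
    have "(\<lambda>n. inverse l ^ n) \<longlonglongrightarrow> 0"
      using l by (intro LIMSEQ_power_zero) (simp add: inverse_less_1_iff)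
    then have "(\<lambda>n. inverse l ^ n * inverse l ^ n) \<longlonglongrightarrow> 0 * 0"
      by (intro tendsto_mult)
    then have r: "r \<longlonglongrightarrow> 0"
      by (simp add: r_def [abs_def] power_inverse)
    have "(\<lambda>n. V (r n)) \<longlonglongrightarrow> V 0"
      unfolding tendsto_matrix_2_iff V_def by (auto intro!: tendsto_eq_intros r)
    then have "(\<lambda>n. det (V (r n) + H ** V (r n) ** adjugate2 H)) \<longlonglongrightarrow> det (V 0 + H ** V 0 ** adjugate2 H)"
      by (intro tendsto_det_2 tendsto_add tendsto_matrix_mult_2 tendsto_const)
    then have "det (V 0 + H ** V 0 ** adjugate2 H) \<le> 0"
      using le by (intro LIMSEQ_le_const2) auto
    \<comment> \<open>A nonzero nilpotent matrix and its conjugate by \<open>H\<close> have a sum of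
      positive determinant unless they share their kernel, that is, unless \<open>H$2$1\<close>
      vanishes.\<close>
    moreover have "det (V 0 + H ** V 0 ** adjugate2 H) = (w$1$2 * H$2$1)\<^sup>2"
      by (simp add: V_def det_2 matrix_mult_2_nth power2_eq_square algebra_simps)
    ultimately show ?thesis
      using H(3) by simp
  qed
  define a c h1 h2 h4 where "a = w$1$1" and "c = w$2$1" and "h1 = H$1$1" and "h2 = H$1$2" and "h4 = H$2$2"
  have w12: "w$1$2 = 0" and w22: "w$2$2 = - a"
    using b[OF w] trace[OF w] by (simp_all add: trace_2 a_def)
  \<comment> \<open>The vanishing of the upper right entry is applied to the conjugates of
    \<open>w\<close> by \<open>H\<close> and by its inverse; adding the resulting equations isolates
    the trace of \<open>H\<close> times \<open>a\<close>.\<close>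
  have "h2 * (2 * h1 * a + h2 * c) = 0" "h2 * (2 * h4 * a - h2 * c) = 0"
    using b[OF conj_H[OF w]] b[OF conj_H'[OF w]] w12 w22
    by (simp_all add: matrix_mult_2_nth algebra_simps flip: a_def c_def h1_def h2_def h4_def)
  then have 1: "2 * h1 * a + h2 * c = 0" "2 * h4 * a - h2 * c = 0"
    using H(2) by (simp_all add: h2_def)
  then have "(h1 + h4) * a = 0"
    by algebra
  then have "a = 0"
    using H(4) by (simp add: trace_2 h1_def h4_def)
  moreover have "c = 0"
    using 1(1) H(2) \<open>a = 0\<close> by (simp add: h2_def)
  ultimately show ?thesis
    using w12 w22 by (simp add: matrix_2_eq_iff a_def c_def)
qed

text \<open>The first-order limit \<open>K\<close> of the near-identity elements of the semigroups is an additive set of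
  non-timelike matrices (trace zero, determinant nonpositive), and conjugation by \<open>M s\<close> preserves it
  up to translation. The directions \<open>w\<close> whose multiples lie in a translate of \<open>K\<close> form an honestly
  invariant cone, which is trivial, whereas normalization makes \<open>K\<close> nontrivial.\<close>

lemma ping_pong_not_limit_of_nonelliptic:
  fixes M :: "'a::finite \<Rightarrow> real^2^2" and X :: "nat \<Rightarrow> real^2^2^'a"
  assumes pp: "ping_pong M bar I"
    and lim: "\<And>s. (\<lambda>k. X k $ s) \<longlonglongrightarrow> M s"
    and sem: "\<And>k B. B \<in> semigroup_generated (range (($) (X k))) \<Longrightarrow> det B = 1 \<and> \<not> elliptic B \<and> B \<noteq> mat 1"
    and s: "hyperbolic (M s)" and t: "t \<noteq> s" "t \<noteq> bar s" "trace (M t) \<noteq> 0"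
  shows False
proof -
  interpret ping_pong M bar I by fact
  \<comment> \<open>The defects of all letters are normalized together, which gives one scale
    \<open>e\<close> for every letter and a limit \<open>D\<close> of norm 1.\<close>
  define U where "U k = (\<chi> s. X k $ s ** X k $ bar s - mat 1)" for k
  have U_nz: "U k \<noteq> 0" for k
  proof -
    have "X k $ s ** X k $ bar s \<in> semigroup_generated (range (($) (X k)))"
      by (intro semigroup_generated.intros) auto
    then have "U k $ s \<noteq> 0"
      using sem by (simp add: U_def)
    then show ?thesis
      by (metis zero_index)
  qed
  have U0: "U \<longlonglongrightarrow> 0"
  proof (rule vec_tendstoI)
    fix s
    have "(\<lambda>k. X k $ s ** X k $ bar s - mat 1) \<longlonglongrightarrow> M s ** M (bar s) - mat 1"
      by (intro tendsto_diff tendsto_matrix_mult_2 lim tendsto_const)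
    then show "(\<lambda>k. U k $ s) \<longlonglongrightarrow> 0 $ s"
      by (simp add: U_def M_bar)
  qed
  have "bounded (range (\<lambda>k. U k /\<^sub>R norm (U k)))"
    using U_nz by (auto simp: bounded_iff intro!: exI[of _ 1])
  then obtain D r where r: "strict_mono (r :: nat \<Rightarrow> nat)"
    and D: "((\<lambda>k. U k /\<^sub>R norm (U k)) \<circ> r) \<longlonglongrightarrow> D"
    using bounded_imp_convergent_subsequence by blast
  define e Y S where "e k = norm (U (r k))" and "Y k = X (r k)"
    and "S k = semigroup_generated (range (($) (Y k)))" for k
  have e_pos: "e k > 0" for k
    using U_nz by (simp add: e_def)
  have e: "e \<longlonglongrightarrow> 0"
    using LIMSEQ_subseq_LIMSEQ[OF tendsto_norm[OF U0] r] by (simp add: e_def [abs_def] comp_def)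
  have Y: "(\<lambda>k. Y k $ s) \<longlonglongrightarrow> M s" for s
    using LIMSEQ_subseq_LIMSEQ[OF lim r] by (simp add: Y_def comp_def)
  have D_lim: "(\<lambda>k. (Y k $ s ** Y k $ bar s - mat 1) /\<^sub>R e k) \<longlonglongrightarrow> D $ s" for s
    using tendsto_vec_nth[OF D, of s] by (simp add: comp_def U_def Y_def e_def)
  have "(\<lambda>k. norm (U (r k) /\<^sub>R norm (U (r k)))) \<longlonglongrightarrow> norm D"
    using tendsto_norm[OF D] by (simp add: comp_def)
  then have "norm D = 1"
    using U_nz LIMSEQ_unique[OF _ tendsto_const] by fastforce
  then have D_nz: "D \<noteq> 0"
    by auto
  define K where "K = {v. \<exists>E. (\<forall>k. E k \<in> S k) \<and> (\<lambda>k. (E k - mat 1) /\<^sub>R e k) \<longlonglongrightarrow> v}"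
  have gen: "Y k $ s \<in> S k" for k s
    unfolding S_def by (intro semigroup_generated.gen) auto
  have mult: "A ** B \<in> S k" if "A \<in> S k" "B \<in> S k" for A B k
    using that unfolding S_def by (rule semigroup_generated.mult)
  have K_I: "v \<in> K" if "\<And>k. E k \<in> S k" "(\<lambda>k. (E k - mat 1) /\<^sub>R e k) \<longlonglongrightarrow> v" for E v
    unfolding K_def mem_Collect_eq by (intro exI[of _ E] conjI allI that)
  have K_E: thesis if "v \<in> K"
      "\<And>E. (\<And>k. E k \<in> S k) \<Longrightarrow> (\<lambda>k. (E k - mat 1) /\<^sub>R e k) \<longlonglongrightarrow> v \<Longrightarrow> thesis" for v thesis
  proof -
    have "\<exists>E. (\<forall>k. E k \<in> S k) \<and> (\<lambda>k. (E k - mat 1) /\<^sub>R e k) \<longlonglongrightarrow> v"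
      using that(1) unfolding K_def mem_Collect_eq .
    then show thesis
      by (elim exE conjE, intro that(2)) (erule spec)
  qed
  have D_K: "D $ s \<in> K" for s
    by (rule K_I[OF mult[OF gen gen] D_lim])
  have K_add: "u + v \<in> K" if u: "u \<in> K" and v: "v \<in> K" for u v
  proof -
    obtain E where E: "\<And>k. E k \<in> S k" "(\<lambda>k. (E k - mat 1) /\<^sub>R e k) \<longlonglongrightarrow> u"
      by (rule K_E[OF u]) (rule that)
    obtain E' where E': "\<And>k. E' k \<in> S k" "(\<lambda>k. (E' k - mat 1) /\<^sub>R e k) \<longlonglongrightarrow> v"
      by (rule K_E[OF v]) (rule that)
    \<comment> \<open>(1 + e A)(1 + e B) = 1 + e (A + B + e A B): to first order, products become
      sums.\<close>
    have "(\<lambda>k. (E k - mat 1) /\<^sub>R e k + (E' k - mat 1) /\<^sub>R e k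
        + e k *\<^sub>R ((E k - mat 1) /\<^sub>R e k ** ((E' k - mat 1) /\<^sub>R e k))) \<longlonglongrightarrow> u + v + 0 *\<^sub>R (u ** v)"
      by (intro tendsto_add tendsto_scaleR tendsto_matrix_mult_2 E E' e)
    moreover have "(E k - mat 1) /\<^sub>R e k + (E' k - mat 1) /\<^sub>R e k
        + e k *\<^sub>R ((E k - mat 1) /\<^sub>R e k ** ((E' k - mat 1) /\<^sub>R e k)) = (E k ** E' k - mat 1) /\<^sub>R e k" for k
      using e_pos[of k] by (simp add: matrix_2_eq_iff matrix_mult_2_nth field_simps)
    ultimately have "(\<lambda>k. (E k ** E' k - mat 1) /\<^sub>R e k) \<longlonglongrightarrow> u + v"
      by simp
    then show ?thesis
      by (rule K_I[OF mult[OF E(1) E'(1)]])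
  qed
  have K_conj: "M s ** v ** M (bar s) + D $ s \<in> K" if v: "v \<in> K" for v s
  proof -
    obtain E where E: "\<And>k. E k \<in> S k" "(\<lambda>k. (E k - mat 1) /\<^sub>R e k) \<longlonglongrightarrow> v"
      by (rule K_E[OF v]) (rule that)
    \<comment> \<open>\<open>Y k $ bar s\<close> only approximates the inverse of
      \<open>Y k $ s\<close>; their defect contributes the translation by
      \<open>D $ s\<close>.\<close>
    have "(\<lambda>k. Y k $ s ** ((E k - mat 1) /\<^sub>R e k) ** Y k $ bar s
        + (Y k $ s ** Y k $ bar s - mat 1) /\<^sub>R e k) \<longlonglongrightarrow> M s ** v ** M (bar s) + D $ s"
      by (intro tendsto_add tendsto_matrix_mult_2 E Y D_lim)
    moreover have "Y k $ s ** ((E k - mat 1) /\<^sub>R e k) ** Y k $ bar s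
        + (Y k $ s ** Y k $ bar s - mat 1) /\<^sub>R e k = (Y k $ s ** E k ** Y k $ bar s - mat 1) /\<^sub>R e k" for k
      using e_pos[of k] by (simp add: matrix_2_eq_iff matrix_mult_2_nth field_simps)
    ultimately have "(\<lambda>k. (Y k $ s ** E k ** Y k $ bar s - mat 1) /\<^sub>R e k) \<longlonglongrightarrow> M s ** v ** M (bar s) + D $ s"
      by simp
    then show ?thesis
      by (rule K_I[OF mult[OF mult[OF gen E(1)] gen]])
  qed
  have K_trace_det: "trace v = 0 \<and> det v \<le> 0" if v: "v \<in> K" for v
  proof -
    obtain E where E: "\<And>k. E k \<in> S k" "(\<lambda>k. (E k - mat 1) /\<^sub>R e k) \<longlonglongrightarrow> v"
      by (rule K_E[OF v]) (rule that)
    define V where "V k = (E k - mat 1) /\<^sub>R e k" for k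
    have V: "V \<longlonglongrightarrow> v"
      using E(2) by (simp add: V_def [abs_def])
    have EV: "E k = mat 1 + e k *\<^sub>R V k" for k
      using e_pos[of k] by (simp add: V_def)
    have "det (E k) = 1 + e k * (trace (V k) + e k * det (V k))" for k
      by (simp add: EV det_2 trace_2 algebra_simps)
    then have tr: "trace (V k) = - (e k * det (V k))" for k
      using sem[of "E k" "r k"] E(1)[of k] e_pos[of k] by (simp add: S_def Y_def)
    have "(\<lambda>k. - (e k * det (V k))) \<longlonglongrightarrow> - (0 * det v)"
      by (intro tendsto_minus tendsto_mult e tendsto_det_2 V)
    then have "trace v = 0"
      using LIMSEQ_unique[OF tendsto_trace_2[OF V]] by (simp add: tr)
    have trE: "trace (E k) = 2 + e k * trace (V k)" for k
      by (simp add: EV trace_2 algebra_simps)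
    have "(\<lambda>k. 2 + e k * trace (V k)) \<longlonglongrightarrow> 2 + 0 * trace v"
      by (intro tendsto_add tendsto_const tendsto_mult e tendsto_trace_2 V)
    \<comment> \<open>A nonelliptic trace is at most -2 or at least 2; near the identity only the
      latter is possible.\<close>
    then have "eventually (\<lambda>k. trace (E k) > -2) sequentially"
      by (intro order_tendstoD(1)[of _ 2]) (simp_all add: trE)
    then have "eventually (\<lambda>k. det (V k) \<le> 0) sequentially"
    proof eventually_elim
      case (elim k)
      have "\<not> elliptic (E k)"
        using sem[of "E k" "r k"] E(1)[of k] by (simp add: S_def Y_def)
      then have "e k * trace (V k) \<ge> 0"
        using elim trE[of k] by (auto simp: elliptic_def)
      then have "trace (V k) \<ge> 0"
        using e_pos[of k] by (simp add: zero_le_mult_iff)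
      then show ?case
        using e_pos[of k] tr[of k] by (simp add: mult_le_0_iff)
    qed
    then have "det v \<le> 0"
      using tendsto_upperbound[OF tendsto_det_2[OF V]] by simp
    with \<open>trace v = 0\<close> show ?thesis
      by simp
  qed
  define C where "C = {w. \<exists>d. \<forall>n. real n *\<^sub>R w + d \<in> K}"
  have K_C: "v \<in> C" if "v \<in> K" for v
  proof -
    \<comment> \<open>The offset \<open>v\<close> also covers n = 0, where 0 itself need not belong
      to \<open>K\<close>.\<close>
    have "real n *\<^sub>R v + v \<in> K" for n
    proof (induction n)
      case (Suc n)
      then show ?case
        using K_add[OF Suc that] by (simp add: algebra_simps)
    qed (simp add: that)
    then show ?thesis
      unfolding C_def by blast
  qed
  have C_add: "u + v \<in> C" if uv: "u \<in> C" "v \<in> C" for u v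
  proof -
    obtain d d' where "\<And>n. real n *\<^sub>R u + d \<in> K" "\<And>n. real n *\<^sub>R v + d' \<in> K"
      using uv unfolding C_def by blast
    then have "real n *\<^sub>R (u + v) + (d + d') \<in> K" for n
      using K_add[of "real n *\<^sub>R u + d" "real n *\<^sub>R v + d'"] by (simp add: algebra_simps)
    then show ?thesis
      unfolding C_def by blast
  qed
  have C_conj: "M s ** w ** M (bar s) \<in> C" if w: "w \<in> C" for w s
  proof -
    obtain d where d: "\<And>n. real n *\<^sub>R w + d \<in> K"
      using w unfolding C_def by blast
    \<comment> \<open>The translation \<open>D $ s\<close> is absorbed into the new offset, so the
      direction is conjugated without error.\<close>
    have "M s ** (real n *\<^sub>R w + d) ** M (bar s) + D $ s
        = real n *\<^sub>R (M s ** w ** M (bar s)) + (M s ** d ** M (bar s) + D $ s)" for n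
      by (simp add: matrix_2_eq_iff matrix_mult_2_nth algebra_simps)
    then have "real n *\<^sub>R (M s ** w ** M (bar s)) + (M s ** d ** M (bar s) + D $ s) \<in> K" for n
      using K_conj[OF d[of n], of s] by (simp add: add.assoc)
    then show ?thesis
      unfolding C_def by blast
  qed
  have C_trace_det: "trace w = 0 \<and> det w \<le> 0" if w: "w \<in> C" for w
  proof -
    obtain d where d: "\<And>n. real n *\<^sub>R w + d \<in> K"
      using w unfolding C_def by blast
    have "trace w = 0"
      using K_trace_det[OF d[of 0]] K_trace_det[OF d[of 1]] by (simp add: trace_2)
    \<comment> \<open>Dividing by the square of the multiple makes the offset disappear in the
      limit; \<open>Suc n\<close> avoids division by zero.\<close>
    have "det (w + inverse (real (Suc n)) *\<^sub>R d) \<le> 0" for n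
    proof -
      have "real (Suc n) *\<^sub>R w + d = real (Suc n) *\<^sub>R (w + inverse (real (Suc n)) *\<^sub>R d)"
        by (simp add: scaleR_add_right)
      moreover have "det (c *\<^sub>R A) = c * c * det A" for c and A :: "real^2^2"
        by (simp add: det_2 algebra_simps)
      ultimately have "real (Suc n) * real (Suc n) * det (w + inverse (real (Suc n)) *\<^sub>R d) \<le> 0"
        using K_trace_det[OF d[of "Suc n"]] by metis
      moreover have "real (Suc n) * real (Suc n) > 0"
        by simp
      ultimately show ?thesis
        by (meson mult_pos_pos not_le)
    qed
    moreover have "(\<lambda>n. det (w + inverse (real (Suc n)) *\<^sub>R d)) \<longlonglongrightarrow> det (w + 0 *\<^sub>R d)"
      by (intro tendsto_det_2 tendsto_add tendsto_scaleR tendsto_const LIMSEQ_inverse_real_of_nat)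
    ultimately have "det w \<le> 0"
      by (intro LIMSEQ_le_const2[of _ "det w"]) auto
    with \<open>trace w = 0\<close> show ?thesis
      by simp
  qed
  obtain P Q :: "real^2^2" and l where PQ: "P ** Q = mat 1" "Q ** P = mat 1" and l: "\<bar>l\<bar> > 1"
    and diag: "(Q ** M s ** P)$1$1 = l" "(Q ** M s ** P)$1$2 = 0" "(Q ** M s ** P)$2$1 = 0"
      "(Q ** M s ** P)$2$2 = 1 / l"
    using hyperbolic_diagonalizable[OF det_M s] by blast
  have P_cancel: "P ** (Q ** Z) = Z" for Z :: "real^2^2"
    by (simp add: matrix_mul_assoc PQ)
  interpret conj: ping_pong "\<lambda>s. Q ** M s ** P" bar "\<lambda>s. (\<lambda>v. P *v v) -` I s"
    by (rule ping_pong_conjugate[OF pp PQ])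
  have adj: "adjugate2 (Q ** M s ** P) = Q ** M (bar s) ** P" for s
    using right_inverse_eq_adjugate2[OF conj.det_M conj.M_bar] by metis
  have tr_PQ: "trace (P ** w ** Q) = trace w" "trace (Q ** w ** P) = trace w" for w
    using trace_mul_sym[of "P ** w" Q] trace_mul_sym[of "Q ** w" P] by (simp_all add: matrix_mul_assoc PQ)
  have det_PQ: "det (P ** w ** Q) = det w" for w
    using PQ(1) det_mul[of P Q] by (simp add: det_mul)
  define C' where "C' = {w. P ** w ** Q \<in> C}"
  have conj_C': "(Q ** M s ** P) ** w ** (Q ** M (bar s) ** P) \<in> C'" if "w \<in> C'" for w s
  proof -
    have "P ** ((Q ** M s ** P) ** w ** (Q ** M (bar s) ** P)) ** Q = M s ** (P ** w ** Q) ** M (bar s)"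
      by (simp only: matrix_mul_assoc[symmetric] P_cancel PQ matrix_mul_rid)
    then show ?thesis
      using C_conj[of "P ** w ** Q" s] that by (simp add: C'_def)
  qed
  have "w = 0" if "w \<in> C'" for w
  proof (rule invariant_cone_trivial_diagonal[OF diag l conj.det_M])
    show "(Q ** M t ** P)$1$2 \<noteq> 0" "(Q ** M t ** P)$2$1 \<noteq> 0"
      by (rule conj.off_diagonal_nonzero[OF diag l t(1,2)])+
    show "trace (Q ** M t ** P) \<noteq> 0"
      using t(3) by (simp add: tr_PQ)
    show "u + v \<in> C'" if "u \<in> C'" "v \<in> C'" for u v
    proof -
      have "P ** (u + v) ** Q = P ** u ** Q + P ** v ** Q"
        by (simp add: matrix_2_eq_iff matrix_mult_2_nth algebra_simps)
      then show ?thesis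
        using C_add[of "P ** u ** Q" "P ** v ** Q"] that by (simp add: C'_def)
    qed
    show "(Q ** M s ** P) ** w ** adjugate2 (Q ** M s ** P) \<in> C'" if "w \<in> C'" for w
      unfolding adj by (rule conj_C'[OF that])
    show "(Q ** M t ** P) ** w ** adjugate2 (Q ** M t ** P) \<in> C'" if "w \<in> C'" for w
      unfolding adj by (rule conj_C'[OF that])
    show "adjugate2 (Q ** M t ** P) ** w ** (Q ** M t ** P) \<in> C'" if "w \<in> C'" for w
      unfolding adj using conj_C'[OF that, of "bar t"] by simp
    show "trace w = 0" "det w \<le> 0" if "w \<in> C'" for w
      using C_trace_det[of "P ** w ** Q"] that by (simp_all add: C'_def tr_PQ det_PQ)
  qed (rule that)
  moreover have "Q ** D $ s ** P \<in> C'" for s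
    using K_C[OF D_K[of s]] by (simp only: C'_def mem_Collect_eq matrix_mul_assoc[symmetric] P_cancel PQ matrix_mul_rid)
  ultimately have "Q ** D $ s ** P = 0" for s
    by blast
  then have "P ** (Q ** D $ s ** P) ** Q = 0" for s
    by simp
  then have "D $ s = 0" for s
    by (simp only: matrix_mul_assoc[symmetric] P_cancel PQ matrix_mul_rid)
  then have "D = 0"
    by (simp add: vec_eq_iff)
  with D_nz show False
    by simp
qed

section \<open>The elliptic locus and the closure of the hyperbolic locus\<close>

lemma ping_pong_notin_elliptic_locus:
  fixes T :: "real^2^2^4"
  assumes "ping_pong (($) T) bar I"
  shows "T \<notin> elliptic_locus"
proof
  interpret ping_pong "($) T" bar I by fact
  assume "T \<in> elliptic_locus"
  then obtain B where "B \<in> semigroup_generated (range (($) T))" "elliptic B"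
    unfolding elliptic_locus_def by blast
  then obtain ws where "elliptic (word_prod (($) T) ws)"
    by (metis semigroup_generated_word)
  moreover have "\<exists>t. t \<noteq> a \<and> t \<noteq> b" for a b :: 4
  proof -
    have "card {a, b} < CARD(4)"
      by (rule le_less_trans[OF card_insert_le_m1[of 2]]) simp_all
    then have "{a, b} \<noteq> UNIV"
      by force
    then show ?thesis
      by auto
  qed
  ultimately show False
    using not_elliptic_word_prod by blast
qed

text \<open>Letter 1 supplies the generator to be diagonalized, and letter 3 a transverse one whose
  trace is nonzero.\<close>

lemma ping_pong_notin_closure_hyperbolic_locus:
  fixes T :: "real^2^2^4"
  assumes pp: "ping_pong (($) T) inverse_letter I" and T: "hyperbolic (T $ 1)" "hyperbolic (T $ 3)"
  shows "T \<notin> top_of_set SL2R_tuples closure_of hyperbolic_locus"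
proof
  assume "T \<in> top_of_set SL2R_tuples closure_of hyperbolic_locus"
  then have "T \<in> closure hyperbolic_locus"
    using closure_of_subtopology_subset[of euclidean SL2R_tuples hyperbolic_locus]
    by (auto simp: closure_of_subtopology closure_mono[THEN subsetD, OF Int_lower2])
  then obtain X where X: "\<And>k. X k \<in> hyperbolic_locus" "X \<longlonglongrightarrow> T"
    unfolding closure_sequential by blast
  show False
  proof (rule ping_pong_not_limit_of_nonelliptic[OF pp, of X 1 3])
    show "(\<lambda>k. X k $ s) \<longlonglongrightarrow> T $ s" for s
      by (rule tendsto_vec_nth[OF X(2)])
    show "det B = 1 \<and> \<not> elliptic B \<and> B \<noteq> mat 1"
      if "B \<in> semigroup_generated (range (($) (X k)))" for k B
      using hyperbolic_locus_semigroup[OF X(1) that] by blast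
    show "trace (T $ 3) \<noteq> 0"
      using T(2) by (auto simp: hyperbolic_def)
  qed (use T in simp_all)
qed

text \<open>The definition of a generating set does not say which of \<open>F\<close> and \<open>H\<close> is paired with the
  intervals \<open>A\<close> and \<open>B\<close>, hence the two cases.\<close>

lemma schottky_generators_ping_pong:
  assumes "F \<in> SL2R" "H \<in> SL2R"
    and "standard_schottky_generating_set {moebius_R F, moebius_R H}"
  shows "\<exists>I. ping_pong (($) (vector [F, matrix_inv F, H, matrix_inv H] :: real^2^2^4)) inverse_letter I"
proof -
  have det: "det F = 1" "det H = 1"
    using assms(1,2) by (simp_all add: SL2R_def)
  obtain f g A B C D where fg: "{moebius_R F, moebius_R H} = {f, g}"
    and I: "open_interval A" "open_interval B" "open_interval C" "open_interval D"
    and disj: "disjnt A B" "disjnt A C" "disjnt A D" "disjnt B C" "disjnt B D" "disjnt C D"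
    and maps: "f ` (- (ext_real_line closure_of A)) = B" "g ` (- (ext_real_line closure_of C)) = D"
    using assms(3) unfolding standard_schottky_generating_set_def by blast
  have op: "openin ext_real_line A" "openin ext_real_line B" "openin ext_real_line C" "openin ext_real_line D"
    and ne: "A \<noteq> {}" "B \<noteq> {}" "C \<noteq> {}" "D \<noteq> {}"
    using I by (simp_all add: open_interval_def)
  from fg consider "f = moebius_R F" "g = moebius_R H" | "f = moebius_R H" "g = moebius_R F"
    by (auto simp: doubleton_eq_iff)
  then show ?thesis
  proof cases
    case 1
    then show ?thesis
      using schottky_ping_pong[OF det op ne disj] maps by simp
  next
    case 2
    have disj': "disjnt C D" "disjnt C A" "disjnt C B" "disjnt D A" "disjnt D B" "disjnt A B"
      using disj by (simp_all add: disjnt_sym)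
    show ?thesis
      using schottky_ping_pong[OF det op(3,4,1,2) ne(3,4,1,2) disj'] maps 2 by simp
  qed
qed

theorem mainTheorem12:
  shows "top_of_set SL2R_tuples closure_of hyperbolic_locus
           \<noteq> SL2R_tuples - (elliptic_locus :: (real^2^2^4) set)
    \<and> (\<forall>F H :: real^2^2.
          F \<in> SL2R \<longrightarrow> H \<in> SL2R \<longrightarrow> hyperbolic F \<longrightarrow> hyperbolic H \<longrightarrow>
          standard_schottky_generating_set {moebius_R F, moebius_R H} \<longrightarrow>
            (vector [F, matrix_inv F, H, matrix_inv H] :: real^2^2^4) \<notin> elliptic_locus \<and>
            (vector [F, matrix_inv F, H, matrix_inv H] :: real^2^2^4)
              \<notin> top_of_set SL2R_tuples closure_of hyperbolic_locus)"
proof -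
  have gen: "(vector [F, matrix_inv F, H, matrix_inv H] :: real^2^2^4) \<notin> elliptic_locus \<and>
      (vector [F, matrix_inv F, H, matrix_inv H] :: real^2^2^4)
        \<notin> top_of_set SL2R_tuples closure_of hyperbolic_locus"
    if FH: "F \<in> SL2R" "H \<in> SL2R" "hyperbolic F" "hyperbolic H"
      "standard_schottky_generating_set {moebius_R F, moebius_R H}" for F H :: "real^2^2"
  proof -
    obtain I where "ping_pong (($) (vector [F, matrix_inv F, H, matrix_inv H] :: real^2^2^4)) inverse_letter I"
      using schottky_generators_ping_pong[OF FH(1,2,5)] by blast
    then show ?thesis
      using ping_pong_notin_elliptic_locus ping_pong_notin_closure_hyperbolic_locus FH(3,4) by simp
  qed
  \<comment> \<open>The inequality of the two sets needs an actual Schottky pair, which the general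
    statement does not provide.\<close>
  define F H :: "real^2^2" where "F = vector [vector [2, 3], vector [1, 2]]"
    and "H = vector [vector [8, -41], vector [1, -5]]"
  note ex = schottky_example[folded F_def H_def]
  define T where "T = (vector [F, matrix_inv F, H, matrix_inv H] :: real^2^2^4)"
  obtain I where "ping_pong (($) T) inverse_letter I"
    unfolding T_def using schottky_generators_ping_pong[OF ex(1,2,5)] by blast
  then have "T \<in> SL2R_tuples"
    using ping_pong.det_M by (fastforce simp: SL2R_tuples_def SL2R_def)
  moreover have "T \<notin> elliptic_locus" "T \<notin> top_of_set SL2R_tuples closure_of hyperbolic_locus"
    using gen[OF ex] by (simp_all add: T_def)
  ultimately have "top_of_set SL2R_tuples closure_of hyperbolic_locus
      \<noteq> SL2R_tuples - (elliptic_locus :: (real^2^2^4) set)"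
    by blast
  with gen show ?thesis
    by blast
qed

end
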